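(* Let $\varphi\colon\mathbb{R}^n\to(-\infty,\infty]$ be continuously prox-regular at $\bar x\in\mathrm{dom}\,\varphi$ for some $\bar v\in\partial\varphi(\bar x)$. Suppose in addition that the subgradient mapping $\partial\varphi$ is metrically regular around $(\bar x,\bar v)$ and that one of the two following properties holds: (i) $\varphi$ is a univariate function, i.e., $n=1$. (ii) $\varphi$ is twice epi-differentiable at $\bar x$ for $\bar v$. Then there exists $d\in\mathbb{R}^n$ satisfying $-\bar v\in\partial^2\varphi(\bar x,\bar v)(d)$.
   Context: For $\Omega\subset\mathbb{R}^s$ and $\bar z\in\Omega$, the regular normal cone is $\widehat N_\Omega(\bar z)=\{v:\limsup_{z\to\bar z,\,z\in\Omega}\frac{\langle v,z-\bar z\rangle}{\|z-\bar z\|}\le 0\}$, and the limiting normal cone is $N_\Omega(\bar z)=\{v:\exists\, z_k\to\bar z,\ z_k\in\Omega,\ v_k\to v\text{ with }v_k\in\widehat N_\Omega(z_k)\}$. For $F\colon\mathbb{R}^n\rightrightarrows\mathbb{R}^m$ and $(x,y)\in\mathrm{gph}\,F$ the limiting coderivative is $D^*F(x,y)(v)=\{u:(u,-v)\in N_{\mathrm{gph}\,F}(x,y)\}$. For $\varphi\colon\mathbb{R}^n\to(-\infty,\infty]$, the limiting subdifferential at $x\in\mathrm{dom}\,\varphi$ is $\partial\varphi(x)=\{v:(v,-1)\in N_{\mathrm{epi}\,\varphi}(x,\varphi(x))\}$ (and $\partial\varphi(x)=\emptyset$ for $x\notin\mathrm{dom}\,\varphi$). The second-order subdifferential at $x$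 for $v\in\partial\varphi(x)$ is $\partial^2\varphi(x,v)(u)=(D^*\partial\varphi)(x,v)(u)$. $\varphi$ is prox-regular at $\bar x\in\mathrm{dom}\,\varphi$ for $\bar v\in\partial\varphi(\bar x)$ with modulus $r>0$ if $\varphi$ is lower semicontinuous around $\bar x$ and there is $\epsilon>0$ such that for all $x,u\in\mathbb{B}_\epsilon(\bar x)$ with $|\varphi(u)-\varphi(\bar x)|<\epsilon$ one has $\varphi(x)\ge\varphi(u)+\langle v,x-u\rangle-\frac r2\|x-u\|^2$ whenever $v\in\partial\varphi(u)\cap\mathbb{B}_\epsilon(\bar v)$. $\varphi$ is subdifferentially continuous at $\bar x$ for $\bar v$ if for any $(x_k,v_k)\to(\bar x,\bar v)$ with $v_k\in\partial\varphi(x_k)$ one has $\varphi(x_k)\to\varphi(\bar x)$. It is continuously prox-regular at $\bar x$ for $\bar v$ if both properties hold. The second subderivative of $\varphi$ at $\bar x$ for $v$ and $w$ is $d^2\varphi(\bar x,v)(w)=\liminf_{\tau\downarrow0,\,u\to w}\frac{\varphi(\bar x+\tau u)-\varphi(\bar x)-\tau\langle v,u\rangle}{\frac12\tau^2}$. $\varphi$ is twice epi-differentiable at $\bar x$ for $v$ if for every $w\in\mathbb{R}^n$ and every $\tau_k\downarrow0$ there is a sequence $w^k\to w$ such that $\frac{\varphi(\bar x+\tau_kw^k)-\varphi(\bar x)-\tau_k\langle v,w^k\rangle}{\frac12\tau_k^2}\to d^2\varphi(\bar x,v)(w)$. $F$ is metrically regular around $(\bar x,\bar y)\in\mathrm{gph}\,F$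 if there are $\mu>0$ and neighborhoods $U$ of $\bar x$, $V$ of $\bar y$ with $\mathrm{dist}(x;F^{-1}(y))\le\mu\,\mathrm{dist}(y;F(x))$ for all $(x,y)\in U\times V$ (distance to the empty set is $\infty$). *)

theory Defs
  imports "HOL-Analysis.Analysis"
begin

section \<open>Normal cones\<close>

text \<open>
  The filter \<open>at zb within \<Omega>\<close> excludes \<open>zb\<close> itself, where the quotient has no meaning. At an
  isolated point of \<open>\<Omega>\<close> the filter is trivial and the limsup is \<open>-\<infinity>\<close>, so that every vector is a
  regular normal. Both cones are only meant to be used at points \<open>zb \<in> \<Omega>\<close>.
\<close>

definition regular_normal_cone :: "'a::euclidean_space set \<Rightarrow> 'a \<Rightarrow> 'a set" where
  "regular_normal_cone \<Omega> zb =
     {v. Limsup (at zb within \<Omega>) (\<lambda>z. ereal ((v \<bullet> (z - zb)) / norm (z - zb))) \<le> 0}"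

definition limiting_normal_cone :: "'a::euclidean_space set \<Rightarrow> 'a \<Rightarrow> 'a set" where
  "limiting_normal_cone \<Omega> zb =
     {v. \<exists>z w. z \<longlonglongrightarrow> zb \<and> w \<longlonglongrightarrow> v \<and>
               (\<forall>k::nat. z k \<in> \<Omega> \<and> w k \<in> regular_normal_cone \<Omega> (z k))}"


section \<open>Set-valued mappings\<close>

definition gph :: "('a \<Rightarrow> 'b set) \<Rightarrow> ('a \<times> 'b) set" where
  "gph F = {(x, y). y \<in> F x}"

definition coderivative ::
    "('a::euclidean_space \<Rightarrow> 'b::euclidean_space set) \<Rightarrow> 'a \<Rightarrow> 'b \<Rightarrow> 'b \<Rightarrow> 'a set" where
  "coderivative F x y v = {u. (u, - v) \<in> limiting_normal_cone (gph F) (x, y)}"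

text \<open>
  The library's \<^const>\<open>infdist\<close> is 0 for the empty set; here the distance to the empty set is \<open>\<infinity>\<close>.
\<close>

definition edist_to :: "'a::metric_space \<Rightarrow> 'a set \<Rightarrow> ereal" where
  "edist_to x S = (INF y\<in>S. ereal (dist x y))"

definition metrically_regular_around ::
    "('a::metric_space \<Rightarrow> 'b::metric_space set) \<Rightarrow> 'a \<Rightarrow> 'b \<Rightarrow> bool" where
  "metrically_regular_around F xb yb \<longleftrightarrow>
     (\<exists>\<mu>>0. \<exists>U V. open U \<and> xb \<in> U \<and> open V \<and> yb \<in> V \<and>
        (\<forall>x\<in>U. \<forall>y\<in>V. edist_to x {x'. y \<in> F x'} \<le> ereal \<mu> * edist_to y (F x)))"


section \<open>Subdifferentials\<close>

text \<open>
  A function into \<open>(-\<infinity>,\<infinity>]\<close> is modelled as an \<^typ>\<open>ereal\<close>-valued function which does not take the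
  value \<open>-\<infinity>\<close>; the latter is left as a separate hypothesis. Then \<open>\<phi> x\<close> is finite on the domain,
  and \<^const>\<open>real_of_ereal\<close> merely changes its type.
\<close>

definition effective_domain :: "('a \<Rightarrow> ereal) \<Rightarrow> 'a set" where
  "effective_domain \<phi> = {x. \<phi> x < \<infinity>}"

definition epi :: "('a \<Rightarrow> ereal) \<Rightarrow> ('a \<times> real) set" where
  "epi \<phi> = {(x, \<alpha>). \<phi> x \<le> ereal \<alpha>}"

definition subdifferential :: "('a::euclidean_space \<Rightarrow> ereal) \<Rightarrow> 'a \<Rightarrow> 'a set" where
  "subdifferential \<phi> x =
     {v. x \<in> effective_domain \<phi> \<and>
         (v, - 1) \<in> limiting_normal_cone (epi \<phi>) (x, real_of_ereal (\<phi> x))}"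

definition second_order_subdifferential ::
    "('a::euclidean_space \<Rightarrow> ereal) \<Rightarrow> 'a \<Rightarrow> 'a \<Rightarrow> 'a \<Rightarrow> 'a set" where
  "second_order_subdifferential \<phi> x v u = coderivative (subdifferential \<phi>) x v u"


section \<open>Continuous prox-regularity\<close>

definition lsc_around :: "('a::euclidean_space \<Rightarrow> ereal) \<Rightarrow> 'a \<Rightarrow> bool" where
  "lsc_around \<phi> xb \<longleftrightarrow> (\<exists>U. open U \<and> xb \<in> U \<and> (\<forall>x\<in>U. \<phi> x \<le> Liminf (at x) \<phi>))"

definition prox_regular_modulus ::
    "('a::euclidean_space \<Rightarrow> ereal) \<Rightarrow> 'a \<Rightarrow> 'a \<Rightarrow> real \<Rightarrow> bool" where
  "prox_regular_modulus \<phi> xb vb r \<longleftrightarrow>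
     lsc_around \<phi> xb \<and>
     (\<exists>\<epsilon>>0. \<forall>x\<in>cball xb \<epsilon>. \<forall>u\<in>cball xb \<epsilon>. \<bar>\<phi> u - \<phi> xb\<bar> < ereal \<epsilon> \<longrightarrow>
        (\<forall>v \<in> subdifferential \<phi> u \<inter> cball vb \<epsilon>.
           \<phi> x \<ge> \<phi> u + ereal (v \<bullet> (x - u) - r / 2 * (norm (x - u))\<^sup>2)))"

definition subdifferentially_continuous ::
    "('a::euclidean_space \<Rightarrow> ereal) \<Rightarrow> 'a \<Rightarrow> 'a \<Rightarrow> bool" where
  "subdifferentially_continuous \<phi> xb vb \<longleftrightarrow>
     (\<forall>x v. x \<longlonglongrightarrow> xb \<and> v \<longlonglongrightarrow> vb \<and> (\<forall>k::nat. v k \<in> subdifferential \<phi> (x k))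
        \<longrightarrow> (\<lambda>k. \<phi> (x k)) \<longlonglongrightarrow> \<phi> xb)"

definition continuously_prox_regular ::
    "('a::euclidean_space \<Rightarrow> ereal) \<Rightarrow> 'a \<Rightarrow> 'a \<Rightarrow> bool" where
  "continuously_prox_regular \<phi> xb vb \<longleftrightarrow>
     (\<exists>r>0. prox_regular_modulus \<phi> xb vb r) \<and> subdifferentially_continuous \<phi> xb vb"


section \<open>Twice epi-differentiability\<close>

definition second_order_quotient ::
    "('a::euclidean_space \<Rightarrow> ereal) \<Rightarrow> 'a \<Rightarrow> 'a \<Rightarrow> real \<Rightarrow> 'a \<Rightarrow> ereal" where
  "second_order_quotient \<phi> xb v \<tau> u =
     (\<phi> (xb + \<tau> *\<^sub>R u) - \<phi> xb - ereal (\<tau> * (v \<bullet> u))) / ereal (1 / 2 * \<tau>\<^sup>2)"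

text \<open>In the limit \<open>u \<rightarrow> w\<close> the value \<open>u = w\<close> is allowed, hence \<^term>\<open>nhds w\<close> and not \<^term>\<open>at w\<close>.\<close>

definition second_subderivative ::
    "('a::euclidean_space \<Rightarrow> ereal) \<Rightarrow> 'a \<Rightarrow> 'a \<Rightarrow> 'a \<Rightarrow> ereal" where
  "second_subderivative \<phi> xb v w =
     Liminf (at_right 0 \<times>\<^sub>F nhds w) (\<lambda>(\<tau>, u). second_order_quotient \<phi> xb v \<tau> u)"

definition twice_epi_differentiable ::
    "('a::euclidean_space \<Rightarrow> ereal) \<Rightarrow> 'a \<Rightarrow> 'a \<Rightarrow> bool" where
  "twice_epi_differentiable \<phi> xb v \<longleftrightarrow>
     (\<forall>w. \<forall>\<tau>. (\<forall>k::nat. \<tau> k > 0) \<and> \<tau> \<longlonglongrightarrow> 0 \<longrightarrow>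
        (\<exists>ws. ws \<longlonglongrightarrow> w \<and>
           (\<lambda>k. second_order_quotient \<phi> xb v (\<tau> k) (ws k)) \<longlonglongrightarrow> second_subderivative \<phi> xb v w))"

end

theory Submission
  imports Defs
begin

text \<open>
  Let \<open>C\<close> be the graph of \<open>\<partial>\<phi>\<close> and \<open>u = -vb\<close>. The claim is that some limiting normal to \<open>C\<close> at
  \<open>(xb, vb)\<close> has first component \<open>u\<close>.

  Prox-regularity and subdifferential continuity make \<open>C\<close> closed near \<open>(xb, vb)\<close> and give a
  prox-inequality at each of its points there (\<open>continuously_prox_regular_localization\<close>); in
  particular \<open>C\<close> is hypomonotone. Metric regularity supplies, for every \<open>y\<close> near \<open>vb\<close>, a point
  \<open>(x, y)\<close> of \<open>C\<close> with \<open>|x - xb| \<le> m |y - vb|\<close> (\<open>metrically_regular_preimage\<close>). Regular normals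
  are then found by maximising smooth functions over \<open>C\<close>, whose gradient at an interior maximum is
  a normal.

  If \<open>\<phi>\<close> is twice epi-differentiable, take the points of \<open>C\<close> over \<open>vb + t u\<close> and let \<open>t\<close> tend to 0;
  a limit of difference quotients is a tangent direction \<open>(w, u)\<close>. For a smooth function the
  derivative of the gradient is a symmetric matrix, so that \<open>(u, -w)\<close> is normal to the graph. The
  substitute for symmetry is that the second subderivative \<open>q\<close> is homogeneous of degree 2 and that
  \<open>\<zeta>\<close> is a proximal subgradient of \<open>q / 2\<close> at \<open>\<xi>\<close> for every tangent \<open>(\<xi>, \<zeta>)\<close>. Euler's identity
  \<open>q \<xi> = \<zeta> \<bullet> \<xi>\<close> (\<open>second_subderivative_at_graphical_tangent\<close>) then shows that \<open>(u, -w)\<close> is a proximal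
  normal at \<open>(w, u)\<close> to the set of tangents, and such normals are limits of regular normals to \<open>C\<close>
  (\<open>limiting_normal_from_tangent_inequality\<close>).

  In dimension one \<open>C\<close> is ordered by \<open>v + (r + 1) x\<close>. Among its points over \<open>vb\<close>, \<open>vb + t\<close> and
  \<open>vb - t\<close> take the middle one \<open>(x2, v2)\<close> and maximise \<open>u x - (K / t) (v - v2)\<^sup>2\<close> over the arc
  between the outer two. For large \<open>K\<close> the maximum is not at an end, which gives normals with first
  component \<open>u\<close> and bounded second component (\<open>limiting_normals_of_hypomonotone_curve\<close>).
\<close>

section \<open>Proximal normals and subgradients\<close>

text \<open>
  Every regular normal below comes out of a maximisation or a prox-inequality, which bounds
  \<open>v \<bullet> (y - z)\<close> by a quadratic. After division by \<open>norm (y - z)\<close> the bound tends to 0.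
\<close>
lemma proximal_normal_is_regular:
  fixes z :: "'a::euclidean_space"
  assumes "e > 0" and "\<And>y. y \<in> \<Omega> \<Longrightarrow> dist y z < e \<Longrightarrow> v \<bullet> (y - z) \<le> K * (norm (y - z))\<^sup>2"
  shows "v \<in> regular_normal_cone \<Omega> z"
  unfolding regular_normal_cone_def mem_Collect_eq Limsup_le_iff
proof (intro allI impI)
  fix c :: ereal assume "0 < c"
  then obtain b where b: "0 < b" "ereal b < c"
    using ereal_dense2 by force
  define e' where "e' = min e (b / (\<bar>K\<bar> + 1))"
  have "e' > 0" using assms(1) b by (simp add: e'_def)
  have "ereal ((v \<bullet> (y - z)) / norm (y - z)) < c"
    if y: "y \<in> \<Omega>" "y \<noteq> z" "dist y z < e'" for y
  proof -
    have pos: "norm (y - z) > 0" using y by simp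
    have "v \<bullet> (y - z) \<le> K * (norm (y - z))\<^sup>2" using assms(2) y by (simp add: e'_def)
    then have "(v \<bullet> (y - z)) / norm (y - z) \<le> K * norm (y - z)"
      using pos by (simp add: power2_eq_square field_simps)
    also have "\<dots> \<le> (\<bar>K\<bar> + 1) * norm (y - z)"
      using pos by (intro mult_right_mono) auto
    also have "\<dots> \<le> b"
    proof -
      have "norm (y - z) < b / (\<bar>K\<bar> + 1)" using y by (simp add: e'_def dist_norm)
      then show ?thesis by (simp add: field_simps)
    qed
    finally show ?thesis using b by (meson ereal_less_eq(3) le_less_trans)
  qed
  then show "\<forall>\<^sub>F y in at z within \<Omega>. ereal ((v \<bullet> (y - z)) / norm (y - z)) < c"
    unfolding eventually_at using \<open>e' > 0\<close> by blast
qed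

lemma regular_imp_limiting_normal:
  assumes "z \<in> \<Omega>" "v \<in> regular_normal_cone \<Omega> z"
  shows "v \<in> limiting_normal_cone \<Omega> z"
  unfolding limiting_normal_cone_def
  unfolding mem_Collect_eq
  using assms by (intro exI[of _ "\<lambda>_. z"] exI[of _ "\<lambda>_. v"]) simp

text \<open>
  The prox-inequality says that \<open>(v, -1)\<close> is a proximal normal to the epigraph. This is how
  membership in \<open>\<partial>\<phi>\<close> survives a limit in which the values of \<open>\<phi>\<close> are only known to be lower
  semicontinuous: the inequality passes to the limit, and it returns a subgradient.
\<close>
lemma proximal_subgradient_in_subdifferential:
  fixes \<phi> :: "'a::euclidean_space \<Rightarrow> ereal"
  assumes fin: "\<phi> x \<noteq> - \<infinity>" "\<phi> x < \<infinity>" and "e > 0"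
    and prox: "\<And>y. y \<in> ball x e \<Longrightarrow> \<phi> y \<ge> \<phi> x + ereal (v \<bullet> (y - x) - r / 2 * (norm (y - x))\<^sup>2)"
  shows "v \<in> subdifferential \<phi> x"
proof -
  obtain a where a: "\<phi> x = ereal a" using fin by (cases "\<phi> x") auto
  have "(v, - 1) \<in> regular_normal_cone (epi \<phi>) (x, a)"
  proof (rule proximal_normal_is_regular[OF \<open>e > 0\<close>, where K = "\<bar>r\<bar> / 2"])
    fix p assume p: "p \<in> epi \<phi>" "dist p (x, a) < e"
    obtain y \<alpha> where [simp]: "p = (y, \<alpha>)" by (cases p)
    have "dist y x < e" using p(2) dist_fst_le[of p "(x, a)"] by simp
    then have "ereal (a + (v \<bullet> (y - x) - r / 2 * (norm (y - x))\<^sup>2)) \<le> \<phi> y"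
      using prox[of y] by (simp add: a dist_commute)
    also have "\<phi> y \<le> ereal \<alpha>" using p by (simp add: epi_def)
    finally have 1: "a + (v \<bullet> (y - x) - r / 2 * (norm (y - x))\<^sup>2) \<le> \<alpha>" by simp
    have "r / 2 * (norm (y - x))\<^sup>2 \<le> \<bar>r\<bar> / 2 * (norm (y - x))\<^sup>2"
      by (intro mult_right_mono) auto
    also have "\<dots> \<le> \<bar>r\<bar> / 2 * (norm (p - (x, a)))\<^sup>2"
      by (intro mult_left_mono) (auto simp: norm_Pair)
    finally show "(v, - 1) \<bullet> (p - (x, a)) \<le> \<bar>r\<bar> / 2 * (norm (p - (x, a)))\<^sup>2"
      using 1 by simp
  qed
  then have "(v, - 1) \<in> limiting_normal_cone (epi \<phi>) (x, a)"
    by (intro regular_imp_limiting_normal) (auto simp: epi_def a)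
  then show ?thesis by (simp add: subdifferential_def effective_domain_def a)
qed

text \<open>
  The second component of the normals is not prescribed in the theorem, so that boundedness of
  it suffices: some subsequence converges.
\<close>
lemma limiting_normal_of_bounded_regular_normals:
  fixes C :: "('a::euclidean_space \<times> 'b::euclidean_space) set"
  assumes p: "p \<longlonglongrightarrow> pb" "\<And>k::nat. p k \<in> C"
    and n: "\<And>k. (u, - w k) \<in> regular_normal_cone C (p k)" and b: "bounded (range w)"
  shows "\<exists>d. (u, - d) \<in> limiting_normal_cone C pb"
proof -
  obtain d \<rho> where \<rho>: "strict_mono \<rho>" and d: "(w \<circ> \<rho>) \<longlonglongrightarrow> d"
    using bounded_imp_convergent_subsequence[OF b] by blast
  have "(u, - d) \<in> limiting_normal_cone C pb"
    unfolding limiting_normal_cone_def mem_Collect_eq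
  proof (intro exI conjI allI)
    show "(p \<circ> \<rho>) \<longlonglongrightarrow> pb" using p \<rho> by (simp add: LIMSEQ_subseq_LIMSEQ)
    show "(\<lambda>k. (u, - w (\<rho> k))) \<longlonglongrightarrow> (u, - d)"
      using d by (intro tendsto_intros) (simp add: o_def)
  qed (use p n in auto)
  then show ?thesis by blast
qed

section \<open>The subdifferential of a continuously prox-regular function\<close>

text \<open>
  Passing to the limit in prox-inequalities. The values \<open>f k\<close> on the smaller side need no limit;
  asymptotically staying above every \<open>a < L\<close> is what lower semicontinuity and the second
  subderivative supply, also for \<open>L = \<infinity>\<close>.
\<close>
lemma ereal_limit_add_le:
  fixes L G :: ereal
  assumes f: "\<And>a. a < L \<Longrightarrow> eventually (\<lambda>k. a < f k) F"
    and c: "(c \<longlongrightarrow> c0) F" and g: "(g \<longlongrightarrow> G) F"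
    and le: "eventually (\<lambda>k. f k + ereal (c k) \<le> g k) F" and F: "F \<noteq> bot"
  shows "L + ereal c0 \<le> G"
proof -
  have "L \<le> G - ereal c0"
  proof (rule dense_le)
    fix a assume "a < L"
    have "((\<lambda>k. g k - ereal (c k)) \<longlongrightarrow> G - ereal c0) F"
      using g c by (intro tendsto_intros) auto
    moreover have "eventually (\<lambda>k. a \<le> g k - ereal (c k)) F"
      using f[OF \<open>a < L\<close>] le
    proof eventually_elim
      case (elim k)
      have "a + ereal (c k) \<le> f k + ereal (c k)" using elim by (intro add_right_mono) auto
      also have "\<dots> \<le> g k" using elim by simp
      finally show ?case by (simp add: ereal_le_minus)
    qed
    ultimately show "a \<le> G - ereal c0" using F by (rule tendsto_lowerbound)
  qed
  then show ?thesis by (simp add: ereal_le_minus)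
qed

lemma lsc_along_sequence:
  fixes f :: "'a::t1_space \<Rightarrow> ereal"
  assumes "f x \<le> Liminf (at x) f" and "(s \<longlongrightarrow> x) F" and "a < f x"
  shows "eventually (\<lambda>k. a < f (s k)) F"
proof -
  have "eventually (\<lambda>y. a < f y) (nhds x)"
    using assms(1,3) by (simp add: eventually_nhds_conv_at le_Liminf_iff)
  then show ?thesis using assms(2) unfolding filterlim_iff by blast
qed

text \<open>
  Subdifferential continuity makes \<open>\<phi> u\<close> close to \<open>\<phi> xb\<close> for every graph point \<open>(u, v)\<close> near
  \<open>(xb, vb)\<close>, so that the restriction on function values in the definition of prox-regularity is
  met automatically. The prox-inequality then holds uniformly over the graph near \<open>(xb, vb)\<close>, and
  being closed under limits it makes the graph locally closed. The test points \<open>x\<close> range over a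
  ball of radius \<open>2 * \<delta>\<close> so that they fill a neighbourhood of each \<open>u \<in> cball xb \<delta>\<close>.
\<close>
lemma continuously_prox_regular_localization:
  fixes \<phi> :: "'a::euclidean_space \<Rightarrow> ereal"
  assumes noninf: "\<And>x. \<phi> x \<noteq> - \<infinity>" and dom: "xb \<in> effective_domain \<phi>"
    and cpr: "continuously_prox_regular \<phi> xb vb"
  obtains r \<delta> where "r > 0" "\<delta> > 0"
    "\<And>u v x. (u, v) \<in> gph (subdifferential \<phi>) \<Longrightarrow> u \<in> cball xb \<delta> \<Longrightarrow> v \<in> cball vb \<delta> \<Longrightarrow>
       x \<in> cball xb (2 * \<delta>) \<Longrightarrow> \<phi> x \<ge> \<phi> u + ereal (v \<bullet> (x - u) - r / 2 * (norm (x - u))\<^sup>2)"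
    "compact (gph (subdifferential \<phi>) \<inter> cball xb \<delta> \<times> cball vb \<delta>)"
proof -
  let ?C = "gph (subdifferential \<phi>)"
  obtain a where a: "\<phi> xb = ereal a"
    using noninf[of xb] dom by (cases "\<phi> xb") (auto simp: effective_domain_def)
  obtain r \<epsilon> U where r: "r > 0" and \<epsilon>: "\<epsilon> > 0" and U: "open U" "xb \<in> U"
    and lsc: "\<And>x. x \<in> U \<Longrightarrow> \<phi> x \<le> Liminf (at x) \<phi>"
    and prox: "\<And>x u v. x \<in> cball xb \<epsilon> \<Longrightarrow> u \<in> cball xb \<epsilon> \<Longrightarrow> \<bar>\<phi> u - \<phi> xb\<bar> < ereal \<epsilon> \<Longrightarrow>
       v \<in> subdifferential \<phi> u \<inter> cball vb \<epsilon> \<Longrightarrow>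
          \<phi> x \<ge> \<phi> u + ereal (v \<bullet> (x - u) - r / 2 * (norm (x - u))\<^sup>2)"
    using cpr unfolding continuously_prox_regular_def prox_regular_modulus_def lsc_around_def
    by metis
  have sc: "subdifferentially_continuous \<phi> xb vb"
    using cpr by (simp add: continuously_prox_regular_def)
  have "\<exists>\<eta>>0. \<forall>u v. (u, v) \<in> ?C \<and> dist u xb \<le> \<eta> \<and> dist v vb \<le> \<eta> \<longrightarrow> \<bar>\<phi> u - \<phi> xb\<bar> < ereal \<epsilon>"
  proof (rule ccontr)
    assume "\<not> ?thesis"
    then have "\<exists>u v. (u, v) \<in> ?C \<and> dist u xb \<le> inverse (real (Suc k)) \<and>
        dist v vb \<le> inverse (real (Suc k)) \<and> \<not> \<bar>\<phi> u - \<phi> xb\<bar> < ereal \<epsilon>" for k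
      by (meson inverse_positive_iff_positive of_nat_0_less_iff zero_less_Suc)
    then obtain u v where uv: "(u k, v k) \<in> ?C" "dist (u k) xb \<le> inverse (real (Suc k))"
        "dist (v k) vb \<le> inverse (real (Suc k))" "\<not> \<bar>\<phi> (u k) - \<phi> xb\<bar> < ereal \<epsilon>" for k
      by metis
    have "u \<longlonglongrightarrow> xb" "v \<longlonglongrightarrow> vb"
      by (rule metric_tendsto_imp_tendsto[OF LIMSEQ_inverse_real_of_nat]; use uv in simp)+
    then have "(\<lambda>k. \<phi> (u k)) \<longlonglongrightarrow> ereal a"
      using sc uv(1) unfolding subdifferentially_continuous_def gph_def a by blast
    then have "eventually (\<lambda>k. \<phi> (u k) > ereal (a - \<epsilon>)) sequentially"
       "eventually (\<lambda>k. \<phi> (u k) < ereal (a + \<epsilon>)) sequentially"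
      using \<epsilon> by (auto intro: order_tendstoD)
    then have "eventually (\<lambda>k::nat. False) sequentially"
    proof eventually_elim
      case (elim k)
      then show ?case using uv(4)[of k] by (cases "\<phi> (u k)") (auto simp: a)
    qed
    then show False by simp
  qed
  then obtain \<eta> where \<eta>: "\<eta> > 0"
    and close: "\<And>u v. (u, v) \<in> ?C \<Longrightarrow> dist u xb \<le> \<eta> \<Longrightarrow> dist v vb \<le> \<eta> \<Longrightarrow> \<bar>\<phi> u - \<phi> xb\<bar> < ereal \<epsilon>"
    by blast
  obtain \<eta>' where \<eta>': "\<eta>' > 0" "cball xb \<eta>' \<subseteq> U" using U open_contains_cball by metis
  define \<delta> where "\<delta> = min (\<epsilon> / 2) (min \<eta> \<eta>')"
  have \<delta>: "\<delta> > 0" "2 * \<delta> \<le> \<epsilon>" "\<delta> \<le> \<eta>" "\<delta> \<le> \<eta>'" using \<epsilon> \<eta> \<eta>' by (auto simp: \<delta>_def)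
  have P: "\<phi> x \<ge> \<phi> u + ereal (v \<bullet> (x - u) - r / 2 * (norm (x - u))\<^sup>2)"
    if "(u, v) \<in> ?C" "u \<in> cball xb \<delta>" "v \<in> cball vb \<delta>" "x \<in> cball xb (2 * \<delta>)" for u v x
  proof (rule prox)
    show "\<bar>\<phi> u - \<phi> xb\<bar> < ereal \<epsilon>" using that \<delta> by (intro close) (auto simp: dist_commute)
  qed (use that \<delta> in \<open>auto simp: gph_def\<close>)
  have "closed (?C \<inter> cball xb \<delta> \<times> cball vb \<delta>)"
    unfolding closed_sequential_limits
  proof (intro allI impI, elim conjE)
    fix z l assume z: "\<forall>k. z k \<in> ?C \<inter> cball xb \<delta> \<times> cball vb \<delta>" and lim: "z \<longlonglongrightarrow> l"
    obtain x v where l: "l = (x, v)" by (cases l)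
    have "l \<in> cball xb \<delta> \<times> cball vb \<delta>"
      by (rule closed_sequentially[OF closed_Times[OF closed_cball closed_cball] _ lim]) (use z in blast)
    then have x: "x \<in> cball xb \<delta>" and v: "v \<in> cball vb \<delta>" by (auto simp: l)
    have l1: "(\<lambda>k. fst (z k)) \<longlonglongrightarrow> x" and l2: "(\<lambda>k. snd (z k)) \<longlonglongrightarrow> v"
      using tendsto_fst[OF lim] tendsto_snd[OF lim] by (simp_all add: l)
    have lscx: "\<phi> x \<le> Liminf (at x) \<phi>" using x \<delta> \<eta>' by (intro lsc) auto
    have Pl: "\<phi> x + ereal (v \<bullet> (y - x) - r / 2 * (norm (y - x))\<^sup>2) \<le> \<phi> y"
      if y: "y \<in> cball xb (2 * \<delta>)" for y
    proof (rule ereal_limit_add_le)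
      show "\<forall>\<^sub>F k in sequentially. b < \<phi> (fst (z k))" if "b < \<phi> x" for b
        using lsc_along_sequence[OF lscx l1 that] .
      show "(\<lambda>k. snd (z k) \<bullet> (y - fst (z k)) - r / 2 * (norm (y - fst (z k)))\<^sup>2)
          \<longlonglongrightarrow> v \<bullet> (y - x) - r / 2 * (norm (y - x))\<^sup>2"
        by (intro tendsto_intros l1 l2)
      have "\<phi> (fst (z k)) + ereal (snd (z k) \<bullet> (y - fst (z k)) - r / 2 * (norm (y - fst (z k)))\<^sup>2) \<le> \<phi> y" for k
        using z[rule_format, of k] y by (intro P) (auto simp: mem_Times_iff)
      then show "\<forall>\<^sub>F k in sequentially. \<phi> (fst (z k)) +
          ereal (snd (z k) \<bullet> (y - fst (z k)) - r / 2 * (norm (y - fst (z k)))\<^sup>2) \<le> \<phi> y"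
        by simp
    qed auto
    \<comment> \<open>The inequality tested at \<open>xb\<close>, where \<open>\<phi>\<close> is finite.\<close>
    have "\<phi> x < \<infinity>" using Pl[of xb] \<delta>(1) by (cases "\<phi> x") (auto simp: a)
    then have "v \<in> subdifferential \<phi> x"
    proof (rule proximal_subgradient_in_subdifferential[OF noninf _ \<delta>(1)])
      fix y assume "y \<in> ball x \<delta>"
      then have "y \<in> cball xb (2 * \<delta>)"
        using x dist_triangle[of xb y x] by simp
      then show "\<phi> x + ereal (v \<bullet> (y - x) - r / 2 * (norm (y - x))\<^sup>2) \<le> \<phi> y" by (rule Pl)
    qed
    then show "l \<in> ?C \<inter> cball xb \<delta> \<times> cball vb \<delta>" using x v by (auto simp: l gph_def)
  qed
  moreover have "bounded (?C \<inter> cball xb \<delta> \<times> cball vb \<delta>)"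
    by (rule bounded_subset[OF bounded_Times[OF bounded_cball bounded_cball]]) auto
  ultimately have "compact (?C \<inter> cball xb \<delta> \<times> cball vb \<delta>)" by (simp add: compact_eq_bounded_closed)
  then show ?thesis using that[OF r \<delta>(1) P] by blast
qed

lemma prox_inequality_imp_hypomonotone:
  assumes "\<phi> x \<noteq> -\<infinity>" "\<phi> x < \<infinity>" "\<phi> x' \<noteq> -\<infinity>" "\<phi> x' < \<infinity>"
    and "\<phi> x' \<ge> \<phi> x + ereal (v \<bullet> (x' - x) - r / 2 * (norm (x' - x))\<^sup>2)"
    and "\<phi> x \<ge> \<phi> x' + ereal (v' \<bullet> (x - x') - r / 2 * (norm (x - x'))\<^sup>2)"
  shows "- r * (norm (x - x'))\<^sup>2 \<le> (v - v') \<bullet> (x - x')"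
proof -
  obtain a b where "\<phi> x = ereal a" "\<phi> x' = ereal b"
    using assms(1-4) by (cases "\<phi> x"; cases "\<phi> x'") auto
  then show ?thesis
    using assms(5,6) by (simp add: norm_minus_commute[of x' x] algebra_simps)
qed

text \<open>
  Metric regularity at the reference point \<open>xb\<close> alone, with \<open>dist y yb\<close> as upper bound for the
  distance of \<open>y\<close> to \<open>F xb\<close>. The distance to the preimage is an infimum, which need not be
  attained; a modulus larger than \<open>\<mu>\<close> makes room for an actual point.
\<close>
lemma metrically_regular_preimage:
  fixes F :: "'a::metric_space \<Rightarrow> 'b::metric_space set"
  assumes "metrically_regular_around F xb yb" and "yb \<in> F xb"
  obtains m V where "m > 0" "open V" "yb \<in> V"
    "\<And>y. y \<in> V \<Longrightarrow> \<exists>x. y \<in> F x \<and> dist x xb \<le> m * dist y yb"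
proof -
  obtain \<mu> U V where \<mu>: "\<mu> > 0" and U: "xb \<in> U" and V: "open V" "yb \<in> V"
    and mr: "\<And>x y. x \<in> U \<Longrightarrow> y \<in> V \<Longrightarrow> edist_to x {x'. y \<in> F x'} \<le> ereal \<mu> * edist_to y (F x)"
    using assms(1) unfolding metrically_regular_around_def by blast
  have "\<exists>x. y \<in> F x \<and> dist x xb \<le> (\<mu> + 1) * dist y yb" if y: "y \<in> V" for y
  proof (cases "y = yb")
    case True
    then show ?thesis using assms(2) by (intro exI[of _ xb]) simp
  next
    case False
    have "edist_to y (F xb) \<le> ereal (dist y yb)"
      unfolding edist_to_def using assms(2) by (intro INF_lower)
    then have "ereal \<mu> * edist_to y (F xb) \<le> ereal \<mu> * ereal (dist y yb)"
      using \<mu> by (intro ereal_mult_left_mono) auto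
    with mr[OF U y] have "edist_to xb {x'. y \<in> F x'} \<le> ereal (\<mu> * dist y yb)" by simp
    also have "\<dots> < ereal ((\<mu> + 1) * dist y yb)" using False \<mu> by (simp add: algebra_simps)
    finally obtain x where "y \<in> F x" "dist xb x < (\<mu> + 1) * dist y yb"
      unfolding edist_to_def INF_less_iff by auto
    then show ?thesis by (intro exI[of _ x]) (simp add: dist_commute)
  qed
  then show ?thesis using that[of "\<mu> + 1" V] \<mu> V by auto
qed

section \<open>Dimension one\<close>

text \<open>
  Here \<open>g\<close> is a parameter along the curve \<open>C\<close>. The function
  \<open>u \<bullet> fst z - \<kappa> * (norm (snd z - snd z2))\<^sup>2\<close> is smaller at both outer points than at the middle
  point \<open>z2\<close>, so that its maximum over the arc between them lies in the interior of the arc. There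
  its gradient is a normal to \<open>C\<close>, and the first component of this gradient is exactly \<open>u\<close>.
\<close>
lemma middle_point_normal:
  fixes C :: "('a::euclidean_space \<times> 'a) set"
  assumes S: "compact S" and inj: "inj_on g S" and cont: "continuous_on UNIV g"
    and z: "z1 \<in> S" "z2 \<in> S" "z3 \<in> S" "g z1 \<le> g z2" "g z2 \<le> (g z3 :: real)"
    and loc: "\<And>z. z \<in> S \<Longrightarrow> g z1 \<le> g z \<Longrightarrow> g z \<le> g z3 \<Longrightarrow> \<exists>e>0. C \<inter> ball z e \<subseteq> S"
    and gap: "u \<bullet> (fst z1 - fst z2) < \<kappa> * (norm (snd z1 - snd z2))\<^sup>2"
      "u \<bullet> (fst z3 - fst z2) < \<kappa> * (norm (snd z3 - snd z2))\<^sup>2"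
    and \<kappa>: "\<kappa> > 0"
  shows "\<exists>p\<in>S. g z1 \<le> g p \<and> g p \<le> g z3 \<and>
     (u, - ((2 * \<kappa>) *\<^sub>R (snd p - snd z2))) \<in> regular_normal_cone C p"
proof -
  define A where "A = S \<inter> {z. g z1 \<le> g z \<and> g z \<le> g z3}"
  have "closed {z. g z1 \<le> g z \<and> g z \<le> g z3}"
    by (intro closed_Collect_conj closed_Collect_le continuous_intros cont)
  then have "compact A" unfolding A_def using S by blast
  define l where "l = (\<lambda>z. u \<bullet> (fst z - fst z2) - \<kappa> * (norm (snd z - snd z2))\<^sup>2)"
  have "z2 \<in> A" using z by (simp add: A_def)
  moreover have "continuous_on A l" unfolding l_def by (intro continuous_intros)
  ultimately obtain p where p: "p \<in> A" and max: "\<And>z. z \<in> A \<Longrightarrow> l z \<le> l p"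
    using continuous_attains_sup[OF \<open>compact A\<close>, of l] by blast
  have "0 \<le> l p" using max[OF \<open>z2 \<in> A\<close>] by (simp add: l_def)
  moreover have "l z1 < 0" "l z3 < 0" using gap by (auto simp: l_def)
  ultimately have "p \<noteq> z1" "p \<noteq> z3" by auto
  \<comment> \<open>Injectivity of the parameter: equal parameters would mean equal points.\<close>
  then have strict: "g z1 < g p" "g p < g z3"
    using p z inj by (auto simp: A_def inj_on_def less_le)
  obtain e where e: "e > 0" "C \<inter> ball p e \<subseteq> S" using loc[of p] p by (auto simp: A_def)
  have "open {z. g z1 < g z \<and> g z < g z3}"
    by (intro open_Collect_conj open_Collect_less continuous_intros cont)
  then obtain e' where e': "e' > 0" "ball p e' \<subseteq> {z. g z1 < g z \<and> g z < g z3}"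
    using strict unfolding open_contains_ball by blast
  have "(u, - ((2 * \<kappa>) *\<^sub>R (snd p - snd z2))) \<in> regular_normal_cone C p"
  proof (rule proximal_normal_is_regular[where e = "min e e'" and K = \<kappa>])
    fix y assume y: "y \<in> C" "dist y p < min e e'"
    then have "y \<in> A" using e e' by (force simp: A_def dist_commute)
    have "l y \<le> l p" by (rule max) fact
    have "(norm (snd y - snd z2))\<^sup>2 = (norm (snd y - snd p))\<^sup>2
        + 2 * ((snd p - snd z2) \<bullet> (snd y - snd p)) + (norm (snd p - snd z2))\<^sup>2"
      by (simp add: power2_norm_eq_inner algebra_simps inner_commute)
    moreover have "u \<bullet> (fst y - fst z2) = u \<bullet> (fst y - fst p) + u \<bullet> (fst p - fst z2)"
      by (simp add: algebra_simps)
    ultimately have "u \<bullet> (fst y - fst p) - 2 * \<kappa> * ((snd p - snd z2) \<bullet> (snd y - snd p))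
        \<le> \<kappa> * (norm (snd y - snd p))\<^sup>2"
      using \<open>l y \<le> l p\<close> by (simp add: l_def ring_distribs mult.left_commute)
    also have "\<dots> \<le> \<kappa> * (norm (y - p))\<^sup>2"
    proof -
      have "norm (snd y - snd p) \<le> norm (y - p)" by (metis norm_snd_le prod.collapse snd_diff)
      then show ?thesis using \<kappa> by (intro mult_left_mono power_mono) auto
    qed
    finally show "(u, - ((2 * \<kappa>) *\<^sub>R (snd p - snd z2))) \<bullet> (y - p) \<le> \<kappa> * (norm (y - p))\<^sup>2"
      by (simp add: inner_prod_def)
  qed (use e e' in auto)
  then show ?thesis using p by (auto simp: A_def)
qed

text \<open>
  In dimension one, hypomonotonicity says that \<open>v + r * x\<close> is nondecreasing in \<open>x\<close> along \<open>C\<close>.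
  Hence \<open>g = v + (r + 1) * x\<close> is a parameter in terms of which both coordinates are Lipschitz:
  points with nearby parameters are near.

  The map \<open>C\<^sup>-\<^sup>1\<close> may have several values, and the points over \<open>vb + t\<close> and \<open>vb - t\<close> may
  both lie on the same side of \<open>(xb, vb)\<close>. Therefore the base point is not \<open>(xb, vb)\<close> but
  whichever of the three points over \<open>vb\<close>, \<open>vb + t\<close>, \<open>vb - t\<close> is in the middle: all three are
  within \<open>O(t)\<close> of each other, while their \<open>v\<close>-coordinates are at least \<open>t\<close> apart. A
  penalty \<open>\<kappa> = K / t\<close> thus outweighs the linear term at the outer points, and the second
  component \<open>2 * \<kappa> * (v - v2)\<close> of the resulting normal stays bounded as \<open>t \<rightarrow> 0\<close>.
\<close>
lemma limiting_normals_of_hypomonotone_curve: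
  fixes C :: "('a::euclidean_space \<times> 'a) set" and u :: 'a
  assumes dim: "DIM('a) = 1" and \<delta>: "\<delta> > 0" and r: "r > 0" and base: "(xb, vb) \<in> C"
    and cpt: "compact (C \<inter> cball xb \<delta> \<times> cball vb \<delta>)"
    and hypo: "\<And>x v x' v'. (x, v) \<in> C \<inter> cball xb \<delta> \<times> cball vb \<delta> \<Longrightarrow>
       (x', v') \<in> C \<inter> cball xb \<delta> \<times> cball vb \<delta> \<Longrightarrow>
       - r * (norm (x - x'))\<^sup>2 \<le> (v - v') \<bullet> (x - x')"
    and m: "m > 0" and V: "open V" "vb \<in> V"
    and pre: "\<And>y. y \<in> V \<Longrightarrow> \<exists>x. (x, y) \<in> C \<and> dist x xb \<le> m * dist y vb"
  shows "\<exists>d. (u, - d) \<in> limiting_normal_cone C (xb, vb)"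
proof -
  define S where "S = C \<inter> cball xb \<delta> \<times> cball vb \<delta>"
  obtain e where B: "(Basis :: 'a set) = {e}" using dim by (metis card_1_singletonE)
  have ip: "x \<bullet> y = (x \<bullet> e) * (y \<bullet> e)" for x y :: 'a
    using euclidean_inner[of x y] by (simp add: B)
  have nrm: "norm x = \<bar>x \<bullet> e\<bar>" for x :: 'a
    by (simp add: norm_eq_sqrt_inner ip[of x x])
  have e1: "norm e = 1" using B norm_Basis by auto
  define c where "c = r + 1"
  define g where "g = (\<lambda>z::'a \<times> 'a. (snd z + c *\<^sub>R fst z) \<bullet> e)"
  define D where "D = 1 + c * m"
  \<comment> \<open>\<open>D * t\<close> bounds the parameters of the three points relative to \<open>(xb, vb)\<close>, and \<open>b * t\<close> the
    distance of the arc between them.\<close>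
  define b where "b = (1 + c) * D"
  have c1: "c > 1" using r by (simp add: c_def)
  have D1: "D > 1" using c1 m by (simp add: D_def)
  have cont: "continuous_on UNIV g" unfolding g_def by (intro continuous_intros)
  have fst_le: "norm (fst z - fst z') \<le> \<bar>g z - g z'\<bar>" if "z \<in> S" "z' \<in> S" for z z'
  proof -
    define \<alpha> \<beta> where "\<alpha> = (fst z - fst z') \<bullet> e" and "\<beta> = (snd z - snd z') \<bullet> e"
    have "- r * (norm (fst z - fst z'))\<^sup>2 \<le> (snd z - snd z') \<bullet> (fst z - fst z')"
      using that by (intro hypo) (auto simp: S_def)
    moreover have "(snd z - snd z') \<bullet> (fst z - fst z') = \<beta> * \<alpha>"
      unfolding \<alpha>_def \<beta>_def by (rule ip)
    moreover have "norm (fst z - fst z') = \<bar>\<alpha>\<bar>" by (simp add: nrm \<alpha>_def)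
    ultimately have "\<alpha>\<^sup>2 \<le> (\<beta> + c * \<alpha>) * \<alpha>"
      by (simp add: c_def power2_eq_square algebra_simps)
    also have "\<beta> + c * \<alpha> = g z - g z'" by (simp add: g_def \<alpha>_def \<beta>_def algebra_simps)
    finally have "\<bar>\<alpha>\<bar> * \<bar>\<alpha>\<bar> \<le> \<bar>g z - g z'\<bar> * \<bar>\<alpha>\<bar>"
      by (metis abs_ge_self abs_mult abs_mult_self_eq order_trans power2_eq_square)
    then have "\<bar>\<alpha>\<bar> \<le> \<bar>g z - g z'\<bar>"
      by (metis abs_ge_zero abs_zero mult_right_le_imp_le zero_less_abs_iff)
    then show ?thesis by (simp add: nrm \<alpha>_def)
  qed
  have snd_le: "norm (snd z - snd z') \<le> (1 + c) * \<bar>g z - g z'\<bar>" if "z \<in> S" "z' \<in> S" for z z'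
  proof -
    have "\<bar>(fst z - fst z') \<bullet> e\<bar> \<le> \<bar>g z - g z'\<bar>" using fst_le[OF that] by (simp add: nrm)
    then have "c * \<bar>(fst z - fst z') \<bullet> e\<bar> \<le> c * \<bar>g z - g z'\<bar>" using c1 by simp
    moreover have "(snd z - snd z') \<bullet> e = (g z - g z') - c * ((fst z - fst z') \<bullet> e)"
      by (simp add: g_def algebra_simps)
    then have "\<bar>(snd z - snd z') \<bullet> e\<bar> \<le> \<bar>g z - g z'\<bar> + c * \<bar>(fst z - fst z') \<bullet> e\<bar>"
      using c1 abs_triangle_ineq4[of "g z - g z'" "c * ((fst z - fst z') \<bullet> e)"]
      by (simp add: abs_mult)
    ultimately show ?thesis by (simp add: nrm algebra_simps)
  qed
  have inj: "inj_on g S"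
  proof (rule inj_onI)
    fix z z' assume "z \<in> S" "z' \<in> S" "g z = g z'"
    then show "z = z'" using fst_le[of z z'] snd_le[of z z'] by (simp add: prod_eq_iff)
  qed
  obtain t0 where t0: "t0 > 0" "ball vb t0 \<subseteq> V" using V open_contains_ball by metis
  define t1 where "t1 = min (t0 / 2) (\<delta> / (2 * b))"
  have b1: "b \<ge> 1 + m"
  proof -
    have "m \<le> c * m" using c1 m by simp
    then have "1 + m \<le> D" by (simp add: D_def)
    also have "D \<le> b" using c1 D1 unfolding b_def by simp
    finally show ?thesis .
  qed
  then have b0: "b > 0" using m by simp
  have t1: "t1 > 0" using t0 \<delta> b0 by (simp add: t1_def)
  \<comment> \<open>The first coordinates of two of the points differ by at most \<open>2 * m * t\<close>, hence \<open>u \<bullet> x\<close> by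
    less than \<open>K * t\<close>.\<close>
  define K where "K = 2 * m * norm u + 1"
  have K: "K > 0" using m by (simp add: K_def add_nonneg_pos)
  define W where "W = 4 * K * b"
  have step: "\<exists>p\<in>C. \<exists>w. dist p (xb, vb) \<le> 2 * b * t \<and> norm w \<le> W \<and> (u, - w) \<in> regular_normal_cone C p"
    if t: "0 < t" "t \<le> t1" for t
  proof -
    have bt: "b * t < \<delta>"
    proof -
      have "t \<le> \<delta> / (2 * b)" using t by (simp add: t1_def)
      then have "2 * (b * t) \<le> \<delta>" using b0 by (simp add: field_simps)
      moreover have "0 < b * t" using b0 t by simp
      ultimately show ?thesis by linarith
    qed
    have "(1 + m) * t \<le> b * t" using b1 t by (intro mult_right_mono) auto
    then have mt: "t + m * t \<le> b * t" by (simp add: algebra_simps)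
    have "0 < m * t" using m t by simp
    have tt: "t < t0" using t t0 by (simp add: t1_def)
    have "vb + t *\<^sub>R e \<in> V" "vb - t *\<^sub>R e \<in> V"
      using t0 t tt e1 by (auto intro!: set_mp[OF t0(2)] simp: dist_norm)
    then obtain x1 x2 where x1: "(x1, vb + t *\<^sub>R e) \<in> C" "dist x1 xb \<le> m * t"
      and x2: "(x2, vb - t *\<^sub>R e) \<in> C" "dist x2 xb \<le> m * t"
      using pre[of "vb + t *\<^sub>R e"] pre[of "vb - t *\<^sub>R e"] t e1 by (auto simp: dist_norm)
    define zb where "zb = (xb, vb)"
    define T where "T = {zb, (x1, vb + t *\<^sub>R e), (x2, vb - t *\<^sub>R e)}"
    have TS: "z \<in> S" if "z \<in> T" for z
      using that x1 x2 base \<delta> t e1 mt bt \<open>0 < m * t\<close>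
      by (auto simp: T_def zb_def S_def dist_norm norm_minus_commute)
    have zbS: "zb \<in> S" by (rule TS) (simp add: T_def)
    have Tx: "norm (fst z - xb) \<le> m * t" if "z \<in> T" for z
      using that x1 x2 \<open>0 < m * t\<close> by (auto simp: T_def zb_def dist_norm)
    have Tv: "norm (snd z - vb) \<le> t" if "z \<in> T" for z
      using that t e1 by (auto simp: T_def zb_def)
    have Tg: "\<bar>g z - g zb\<bar> \<le> D * t" if z: "z \<in> T" for z
    proof -
      have "g z - g zb = (snd z - vb) \<bullet> e + c * ((fst z - xb) \<bullet> e)"
        by (simp add: g_def zb_def algebra_simps)
      then have "\<bar>g z - g zb\<bar> \<le> \<bar>(snd z - vb) \<bullet> e\<bar> + c * \<bar>(fst z - xb) \<bullet> e\<bar>"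
        using abs_triangle_ineq[of "(snd z - vb) \<bullet> e" "c * ((fst z - xb) \<bullet> e)"] c1
        by (simp add: abs_mult)
      also have "\<dots> \<le> t + c * (m * t)"
        using Tx[OF z] Tv[OF z] c1 by (intro add_mono mult_left_mono) (auto simp: nrm)
      finally show ?thesis by (simp add: D_def algebra_simps)
    qed
    \<comment> \<open>The argument for an arbitrary ordering \<open>z1, z2, z3\<close> of the three points.\<close>
    have main: ?thesis
      if z: "z1 \<in> T" "z2 \<in> T" "z3 \<in> T" "g z1 \<le> g z2" "g z2 \<le> g z3"
        and far: "t \<le> norm (snd z1 - snd z2)" "t \<le> norm (snd z3 - snd z2)" for z1 z2 z3
    proof -
      have close: "norm (fst p - xb) \<le> D * t \<and> norm (snd p - vb) \<le> b * t"
        if p: "p \<in> S" "g z1 \<le> g p" "g p \<le> g z3" for p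
      proof -
        have "\<bar>g p - g zb\<bar> \<le> D * t" using p Tg[OF z(1)] Tg[OF z(3)] by linarith
        moreover from this have "(1 + c) * \<bar>g p - g zb\<bar> \<le> b * t"
          using c1 unfolding b_def mult.assoc by (intro mult_left_mono) auto
        ultimately show ?thesis
          using fst_le[OF p(1) zbS] snd_le[OF p(1) zbS] by (simp add: zb_def)
      qed
      have "D * t \<le> b * t" using c1 D1 t by (simp add: b_def)
      have loc: "\<exists>e>0. C \<inter> ball p e \<subseteq> S" if p: "p \<in> S" "g z1 \<le> g p" "g p \<le> g z3" for p
      proof -
        have "p \<in> ball xb \<delta> \<times> ball vb \<delta>"
          using close[OF p] bt \<open>D * t \<le> b * t\<close>
          by (auto simp: mem_Times_iff dist_norm norm_minus_commute)
        then obtain e where "e > 0" "ball p e \<subseteq> ball xb \<delta> \<times> ball vb \<delta>"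
          using open_Times[OF open_ball open_ball] open_contains_ball by metis
        then show ?thesis by (intro exI[of _ e]) (auto simp: S_def)
      qed
      have gap: "u \<bullet> (fst z - fst z2) < K / t * (norm (snd z - snd z2))\<^sup>2"
        if zT: "z \<in> T" and f: "t \<le> norm (snd z - snd z2)" for z
      proof -
        have "norm (fst z - fst z2) \<le> norm (fst z - xb) + norm (fst z2 - xb)"
          using norm_triangle_ineq4[of "fst z - xb" "fst z2 - xb"] by simp
        also have "\<dots> \<le> 2 * m * t" using Tx[OF zT] Tx[OF z(2)] by simp
        finally have "norm u * norm (fst z - fst z2) \<le> norm u * (2 * m * t)"
          by (intro mult_left_mono) auto
        then have "u \<bullet> (fst z - fst z2) \<le> norm u * (2 * m * t)"
          using norm_cauchy_schwarz[of u "fst z - fst z2"] by linarith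
        also have "\<dots> < K * t" using t by (simp add: K_def algebra_simps)
        also have "K * t = K / t * t\<^sup>2" using t by (simp add: power2_eq_square)
        also have "\<dots> \<le> K / t * (norm (snd z - snd z2))\<^sup>2"
          using t K f by (intro mult_left_mono power_mono) auto
        finally show ?thesis .
      qed
      obtain p where p: "p \<in> S" "g z1 \<le> g p" "g p \<le> g z3"
        and n: "(u, - ((2 * (K / t)) *\<^sub>R (snd p - snd z2))) \<in> regular_normal_cone C p"
        using middle_point_normal[OF cpt[folded S_def] inj cont TS[OF z(1)] TS[OF z(2)] TS[OF z(3)]
            z(4,5) loc gap[OF z(1) far(1)] gap[OF z(3) far(2)]] K t by auto
      have "dist p (xb, vb) \<le> norm (fst p - xb) + norm (snd p - vb)"
        using norm_Pair_le[of "fst p - xb" "snd p - vb"] by (cases p) (simp add: dist_norm)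
      then have 1: "dist p (xb, vb) \<le> 2 * b * t"
        using close[OF p] \<open>D * t \<le> b * t\<close> by linarith
      have "norm (snd p - snd z2) \<le> norm (snd p - vb) + norm (snd z2 - vb)"
        using norm_triangle_ineq4[of "snd p - vb" "snd z2 - vb"] by simp
      also have "\<dots> \<le> 2 * b * t" using close[OF p] Tv[OF z(2)] mt \<open>0 < m * t\<close> by linarith
      finally have "(2 * (K / t)) * norm (snd p - snd z2) \<le> (2 * (K / t)) * (2 * b * t)"
        using K t by (intro mult_left_mono) auto
      then have "norm ((2 * (K / t)) *\<^sub>R (snd p - snd z2)) \<le> W"
        using K t by (simp add: W_def mult_ac)
      moreover have "p \<in> C" using p(1) by (simp add: S_def)
      ultimately show ?thesis using n 1 by blast
    qed
    define za where "za = (x1, vb + t *\<^sub>R e)"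
    define zc where "zc = (x2, vb - t *\<^sub>R e)"
    have T: "za \<in> T" "zb \<in> T" "zc \<in> T" by (simp_all add: T_def za_def zc_def)
    have "snd za - snd zb = t *\<^sub>R e" "snd zb - snd zc = t *\<^sub>R e" "snd za - snd zc = (2 * t) *\<^sub>R e"
      by (simp_all add: za_def zb_def zc_def algebra_simps flip: scaleR_2)
    then have f: "t \<le> norm (snd za - snd zb)" "t \<le> norm (snd zb - snd zc)" "t \<le> norm (snd za - snd zc)"
      using t e1 by simp_all
    then have f': "t \<le> norm (snd zb - snd za)" "t \<le> norm (snd zc - snd zb)" "t \<le> norm (snd zc - snd za)"
      by (simp_all only: norm_minus_commute)
    consider "g za \<le> g zb" "g zb \<le> g zc" | "g za \<le> g zc" "g zc \<le> g zb" | "g zb \<le> g za" "g za \<le> g zc"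
      | "g zb \<le> g zc" "g zc \<le> g za" | "g zc \<le> g za" "g za \<le> g zb" | "g zc \<le> g zb" "g zb \<le> g za"
      by linarith
    then show ?thesis
    proof cases
      case 1 then show ?thesis using main[OF T(1,2,3)] f f' by simp
    next
      case 2 then show ?thesis using main[OF T(1,3,2)] f f' by simp
    next
      case 3 then show ?thesis using main[OF T(2,1,3)] f f' by simp
    next
      case 4 then show ?thesis using main[OF T(2,3,1)] f f' by simp
    next
      case 5 then show ?thesis using main[OF T(3,1,2)] f f' by simp
    next
      case 6 then show ?thesis using main[OF T(3,2,1)] f f' by simp
    qed
  qed
  define t where "t = (\<lambda>k. t1 * inverse (real (Suc k)))"
  have t: "0 < t k" "t k \<le> t1" for k
    using t1 mult_left_le[of "inverse (real (Suc k))" t1] by (auto simp: t_def inverse_le_1_iff)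
  have "\<exists>p w. p \<in> C \<and> dist p (xb, vb) \<le> 2 * b * t k \<and> norm w \<le> W \<and>
      (u, - w) \<in> regular_normal_cone C p" for k
    using step[OF t] by blast
  then obtain p w where p: "\<And>k. p k \<in> C" and pd: "\<And>k. dist (p k) (xb, vb) \<le> 2 * b * t k"
    and w: "\<And>k. norm (w k) \<le> W" and n: "\<And>k. (u, - w k) \<in> regular_normal_cone C (p k)"
    by metis
  have "(\<lambda>k. 2 * b * t k) \<longlonglongrightarrow> 0"
    unfolding t_def by (intro tendsto_mult_right_zero LIMSEQ_inverse_real_of_nat)
  then have "p \<longlonglongrightarrow> (xb, vb)"
    by (rule metric_tendsto_imp_tendsto) (use pd t b0 in \<open>auto intro!: always_eventually simp: less_imp_le\<close>)
  moreover have "bounded (range w)" using w by (auto simp: bounded_iff)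
  ultimately show ?thesis using limiting_normal_of_bounded_regular_normals p n by blast
qed

section \<open>Second subderivatives and graphical tangents\<close>

text \<open>
  The prox-inequality at the graph point \<open>(xb + \<tau> \<xi>, vb + \<tau> \<zeta>)\<close> after subtracting the affine part
  and rescaling. The linear term at \<open>vb\<close> cancels, so that the quotient satisfies the
  prox-inequality of a function with subgradient \<open>2 \<zeta>\<close> at \<open>\<xi>\<close>.
\<close>
lemma second_order_quotient_prox_inequality:
  assumes \<tau>: "\<tau> > 0" and a: "\<phi> xb = ereal a"
    and noninf: "\<And>x. \<phi> x \<noteq> - \<infinity>"
    and le: "\<phi> (xb + \<tau> *\<^sub>R \<xi>) + ereal ((vb + \<tau> *\<^sub>R \<zeta>) \<bullet> (\<tau> *\<^sub>R (y - \<xi>))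
       - r / 2 * (norm (\<tau> *\<^sub>R (y - \<xi>)))\<^sup>2) \<le> \<phi> (xb + \<tau> *\<^sub>R y)"
  shows "second_order_quotient \<phi> xb vb \<tau> \<xi> + ereal (2 * (\<zeta> \<bullet> (y - \<xi>)) - r * (norm (y - \<xi>))\<^sup>2)
    \<le> second_order_quotient \<phi> xb vb \<tau> y"
proof (cases "\<phi> (xb + \<tau> *\<^sub>R y)")
  case (real Y)
  then obtain X where X: "\<phi> (xb + \<tau> *\<^sub>R \<xi>) = ereal X"
    using le noninf[of "xb + \<tau> *\<^sub>R \<xi>"] by (cases "\<phi> (xb + \<tau> *\<^sub>R \<xi>)") auto
  define d n where "d = y - \<xi>" and "n = (norm d)\<^sup>2"
  have y: "y = \<xi> + d" by (simp add: d_def)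
  have "X + \<tau> * (vb \<bullet> d) + \<tau>\<^sup>2 * (\<zeta> \<bullet> d) - r / 2 * (\<tau>\<^sup>2 * n) \<le> Y"
    using le unfolding X real d_def[symmetric]
    using \<tau> by (simp add: n_def power_mult_distrib algebra_simps power2_eq_square)
  then have "(X - a - \<tau> * (vb \<bullet> \<xi>)) + (2 * (\<zeta> \<bullet> d) - r * n) * (1 / 2 * \<tau>\<^sup>2)
      \<le> Y - a - \<tau> * (vb \<bullet> y)"
    unfolding y by (simp add: algebra_simps)
  moreover have "A / h + b \<le> B / h" if "A + b * h \<le> B" "h > 0" for A B b h :: real
    using that divide_right_mono[of "A + b * h" B h] by (simp add: add_divide_distrib)
  ultimately have "(X - a - \<tau> * (vb \<bullet> \<xi>)) / (1 / 2 * \<tau>\<^sup>2) + (2 * (\<zeta> \<bullet> d) - r * n)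
      \<le> (Y - a - \<tau> * (vb \<bullet> y)) / (1 / 2 * \<tau>\<^sup>2)"
    using \<tau> by simp
  then show ?thesis using \<tau>
    by (simp add: second_order_quotient_def X real a d_def[symmetric] n_def[symmetric])
next
  case PInf
  then show ?thesis using \<tau> by (simp add: second_order_quotient_def a)
qed (use noninf in simp)

lemma second_subderivative_le_along_sequence:
  assumes \<tau>: "\<tau> \<longlonglongrightarrow> 0" "\<And>k::nat. \<tau> k > 0" and y: "ys \<longlonglongrightarrow> y"
    and b: "b < second_subderivative \<phi> xb v y"
  shows "eventually (\<lambda>k. b < second_order_quotient \<phi> xb v (\<tau> k) (ys k)) sequentially"
proof -
  have "filterlim \<tau> (at_right 0) sequentially"
    using \<tau> by (auto simp: filterlim_at intro!: always_eventually) (metis less_irrefl)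
  then have "filterlim (\<lambda>k. (\<tau> k, ys k)) (at_right 0 \<times>\<^sub>F nhds y) sequentially"
    using y by (rule filterlim_Pair)
  moreover have "eventually (\<lambda>p. b < (case p of (\<tau>, u) \<Rightarrow> second_order_quotient \<phi> xb v \<tau> u))
      (at_right 0 \<times>\<^sub>F nhds y)"
    using b unfolding second_subderivative_def by (rule less_LiminfD)
  ultimately show ?thesis unfolding filterlim_iff by force
qed

lemma second_order_quotient_scale:
  assumes "\<mu> > 0" "\<tau> > 0"
  shows "second_order_quotient \<phi> xb v \<tau> (\<mu> *\<^sub>R y)
     = ereal (\<mu>\<^sup>2) * second_order_quotient \<phi> xb v (\<mu> * \<tau>) y"
proof -
  define X where "X = \<phi> (xb + (\<mu> * \<tau>) *\<^sub>R y) - \<phi> xb - ereal (\<mu> * (\<tau> * (v \<bullet> y)))"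
  have "X / ereal (1 / 2 * \<tau>\<^sup>2) = ereal (\<mu>\<^sup>2) * (X / ereal (1 / 2 * (\<mu> * \<tau>)\<^sup>2))"
    using assms by (cases X) (auto simp: field_simps)
  then show ?thesis by (simp add: second_order_quotient_def X_def mult_ac)
qed

text \<open>
  One half of positive homogeneity of degree 2. The step sizes \<open>\<tau>\<close> and \<open>\<mu> * \<tau>\<close> give the same
  quotients up to the factor \<open>\<mu>\<^sup>2\<close>, and a recovery sequence for \<open>y\<close> along \<open>\<mu> * \<tau>\<close>
  bounds the lower limit at \<open>\<mu> y\<close> along \<open>\<tau>\<close>.
\<close>
lemma second_subderivative_scale_le:
  assumes epi: "twice_epi_differentiable \<phi> xb v" and \<mu>: "\<mu> > 0"
    and fin: "second_subderivative \<phi> xb v y = ereal Q"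
  shows "second_subderivative \<phi> xb v (\<mu> *\<^sub>R y) \<le> ereal (\<mu>\<^sup>2 * Q)"
proof (rule dense_ge)
  fix c assume "ereal (\<mu>\<^sup>2 * Q) < c"
  show "second_subderivative \<phi> xb v (\<mu> *\<^sub>R y) \<le> c"
  proof (rule ccontr)
    assume "\<not> ?thesis"
    then have c: "c < second_subderivative \<phi> xb v (\<mu> *\<^sub>R y)" by simp
    define \<tau> where "\<tau> = (\<lambda>k. inverse (real (Suc k)))"
    have \<tau>: "\<tau> \<longlonglongrightarrow> 0" "\<And>k. \<tau> k > 0"
      unfolding \<tau>_def by (rule LIMSEQ_inverse_real_of_nat) simp
    have \<tau>': "(\<forall>k. \<mu> * \<tau> k > 0) \<and> (\<lambda>k. \<mu> * \<tau> k) \<longlonglongrightarrow> 0"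
      using \<tau> \<mu> by (auto intro: tendsto_mult_right_zero)
    obtain ys where ys: "ys \<longlonglongrightarrow> y"
      and lim: "(\<lambda>k. second_order_quotient \<phi> xb v (\<mu> * \<tau> k) (ys k)) \<longlonglongrightarrow> ereal Q"
      using epi[unfolded twice_epi_differentiable_def, rule_format, OF \<tau>', of y] fin by auto
    have "(\<lambda>k. ereal (\<mu>\<^sup>2) * second_order_quotient \<phi> xb v (\<mu> * \<tau> k) (ys k))
        \<longlonglongrightarrow> ereal (\<mu>\<^sup>2) * ereal Q"
      by (intro tendsto_cmult_ereal lim) simp
    then have "(\<lambda>k. second_order_quotient \<phi> xb v (\<tau> k) (\<mu> *\<^sub>R ys k)) \<longlonglongrightarrow> ereal (\<mu>\<^sup>2 * Q)"
      by (simp add: second_order_quotient_scale[OF \<mu> \<tau>(2)])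
    then have "eventually (\<lambda>k. second_order_quotient \<phi> xb v (\<tau> k) (\<mu> *\<^sub>R ys k) < c) sequentially"
      using \<open>ereal (\<mu>\<^sup>2 * Q) < c\<close> by (rule order_tendstoD)
    moreover have "eventually (\<lambda>k. c < second_order_quotient \<phi> xb v (\<tau> k) (\<mu> *\<^sub>R ys k)) sequentially"
      by (rule second_subderivative_le_along_sequence[OF \<tau> tendsto_scaleR[OF tendsto_const ys] c])
    ultimately have "eventually (\<lambda>k::nat. False) sequentially" by eventually_elim simp
    then show False by simp
  qed
qed

text \<open>
  Write \<open>q\<close> for the second subderivative and let \<open>(\<xi>, \<zeta>)\<close> be a tangent direction to the graph.
  Recovery sequences turn the prox-inequalities for the quotients into
  \<open>q y \<ge> q \<xi> + 2 \<zeta> \<bullet> (y - \<xi>) - r |y - \<xi>|\<^sup>2\<close>, that is, \<open>\<zeta>\<close> is a proximal subgradient of \<open>q / 2\<close>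
  at \<open>\<xi>\<close>. On the ray through \<open>\<xi>\<close>, where \<open>q\<close> is homogeneous of degree 2, this forces the Euler
  identity \<open>q \<xi> = \<zeta> \<bullet> \<xi>\<close>.
\<close>
lemma second_subderivative_at_graphical_tangent:
  fixes \<phi> :: "'a::euclidean_space \<Rightarrow> ereal"
  assumes noninf: "\<And>x. \<phi> x \<noteq> - \<infinity>" and dom: "xb \<in> effective_domain \<phi>" and \<delta>: "\<delta> > 0"
    and prox: "\<And>u v x. (u, v) \<in> C \<Longrightarrow> u \<in> cball xb \<delta> \<Longrightarrow> v \<in> cball vb \<delta> \<Longrightarrow>
       x \<in> cball xb (2 * \<delta>) \<Longrightarrow> \<phi> x \<ge> \<phi> u + ereal (v \<bullet> (x - u) - r / 2 * (norm (x - u))\<^sup>2)"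
    and base: "(xb, vb) \<in> C"
    and epi: "twice_epi_differentiable \<phi> xb vb"
    and \<tau>: "\<tau> \<longlonglongrightarrow> 0" "\<And>k::nat. \<tau> k > 0"
    and \<xi>: "\<xi>s \<longlonglongrightarrow> \<xi>" and \<zeta>: "\<zeta>s \<longlonglongrightarrow> \<zeta>"
    and inC: "\<And>k. (xb + \<tau> k *\<^sub>R \<xi>s k, vb + \<tau> k *\<^sub>R \<zeta>s k) \<in> C"
  shows "second_subderivative \<phi> xb vb \<xi> = ereal (\<zeta> \<bullet> \<xi>)"
    and "ereal (\<zeta> \<bullet> \<xi> + 2 * (\<zeta> \<bullet> (y - \<xi>)) - r * (norm (y - \<xi>))\<^sup>2) \<le> second_subderivative \<phi> xb vb y"
proof -
  let ?q = "second_subderivative \<phi> xb vb" and ?\<Delta> = "second_order_quotient \<phi> xb vb"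
  obtain a where a: "\<phi> xb = ereal a"
    using noninf[of xb] dom by (cases "\<phi> xb") (auto simp: effective_domain_def)
  have small: "eventually (\<lambda>k. xb + \<tau> k *\<^sub>R ws k \<in> cball xb \<rho>) sequentially"
    if ws: "ws \<longlonglongrightarrow> w" and \<rho>: "\<rho> > 0" for ws :: "nat \<Rightarrow> 'a" and w \<rho> xb
  proof -
    have "(\<lambda>k. xb + \<tau> k *\<^sub>R ws k) \<longlonglongrightarrow> xb + 0 *\<^sub>R w" by (intro tendsto_intros \<tau> ws)
    then have "eventually (\<lambda>k. dist (xb + \<tau> k *\<^sub>R ws k) xb < \<rho>) sequentially"
      using \<rho> by (auto dest: tendstoD)
    then show ?thesis by eventually_elim (simp add: dist_norm)
  qed
  have \<Delta>_le: "eventually (\<lambda>k. ?\<Delta> (\<tau> k) (xs k) + ereal (2 * (zs k \<bullet> (ys k - xs k)) - r * (norm (ys k - xs k))\<^sup>2)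
      \<le> ?\<Delta> (\<tau> k) (ys k)) sequentially"
    if xs: "xs \<longlonglongrightarrow> x" and zs: "zs \<longlonglongrightarrow> z" and ys: "ys \<longlonglongrightarrow> y"
      and in_C: "\<And>k. (xb + \<tau> k *\<^sub>R xs k, vb + \<tau> k *\<^sub>R zs k) \<in> C" for xs zs ys x y z
  proof -
    have "2 * \<delta> > 0" using \<delta> by simp
    show ?thesis using small[OF xs \<delta>, of xb] small[OF zs \<delta>, of vb] small[OF ys \<open>2 * \<delta> > 0\<close>, of xb]
    proof eventually_elim
      case (elim k)
      have "\<tau> k *\<^sub>R ys k - \<tau> k *\<^sub>R xs k = \<tau> k *\<^sub>R (ys k - xs k)" by (simp add: algebra_simps)
      then show ?case
        using prox[OF in_C elim] by (intro second_order_quotient_prox_inequality[where \<phi> = \<phi>, OF \<tau>(2) a noninf]) simp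
    qed
  qed
  have lower: "?q \<xi> + ereal (2 * (\<zeta> \<bullet> (y - \<xi>)) - r * (norm (y - \<xi>))\<^sup>2) \<le> ?q y" for y
  proof -
    obtain ys where ys: "ys \<longlonglongrightarrow> y" and lim: "(\<lambda>k. ?\<Delta> (\<tau> k) (ys k)) \<longlonglongrightarrow> ?q y"
      using epi \<tau> unfolding twice_epi_differentiable_def by meson
    show ?thesis
    proof (rule ereal_limit_add_le[OF _ _ lim \<Delta>_le[OF \<xi> \<zeta> ys inC]])
      show "eventually (\<lambda>k. c < ?\<Delta> (\<tau> k) (\<xi>s k)) sequentially" if "c < ?q \<xi>" for c
        by (rule second_subderivative_le_along_sequence[OF \<tau> \<xi> that])
    qed (intro tendsto_intros \<xi> \<zeta> ys | simp)+
  qed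
  have \<Delta>0: "?\<Delta> (\<tau> k) 0 = 0" for k
    using \<tau>(2)[of k] by (simp add: second_order_quotient_def a zero_ereal_def)
  \<comment> \<open>Finiteness of \<open>q \<xi>\<close>: the inequality tested at 0 bounds it from above, and the one with base
    point \<open>(xb, vb)\<close> itself, the tangent \<open>(0, 0)\<close>, from below.\<close>
  have q0: "?q 0 \<le> 0"
  proof (rule ccontr)
    assume "\<not> ?thesis"
    then have "eventually (\<lambda>k. 0 < ?\<Delta> (\<tau> k) 0) sequentially"
      by (intro second_subderivative_le_along_sequence[OF \<tau> tendsto_const]) simp
    then show False by (simp add: \<Delta>0)
  qed
  have "?q \<xi> \<noteq> \<infinity>" using lower[of 0] q0 by auto
  moreover have "?q \<xi> \<noteq> - \<infinity>"
  proof -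
    obtain ys where ys: "ys \<longlonglongrightarrow> \<xi>" and lim: "(\<lambda>k. ?\<Delta> (\<tau> k) (ys k)) \<longlonglongrightarrow> ?q \<xi>"
      using epi \<tau> unfolding twice_epi_differentiable_def by meson
    have "0 + ereal (2 * (0 \<bullet> (\<xi> - 0)) - r * (norm (\<xi> - 0))\<^sup>2) \<le> ?q \<xi>"
    proof (rule ereal_limit_add_le[OF _ _ lim \<Delta>_le[OF tendsto_const tendsto_const ys, of 0 0]])
      show "eventually (\<lambda>k. c < ?\<Delta> (\<tau> k) 0) sequentially" if "c < 0" for c
        using that by (simp add: \<Delta>0)
    qed (use base in \<open>(intro tendsto_intros ys | simp)+\<close>)
    then show ?thesis by auto
  qed
  ultimately obtain Q where Q: "?q \<xi> = ereal Q" by (cases "?q \<xi>") auto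
  \<comment> \<open>The slack of the inequality at \<open>y = \<mu> \<xi>\<close>: it is nonnegative and vanishes at \<open>\<mu> = 1\<close>, so
    its derivative there is 0.\<close>
  define f where "f = (\<lambda>\<mu>. \<mu>\<^sup>2 * Q - Q - 2 * (\<mu> - 1) * (\<zeta> \<bullet> \<xi>) + r * (\<mu> - 1)\<^sup>2 * (norm \<xi>)\<^sup>2)"
  have f0: "0 \<le> f \<mu>" if "\<mu> > 0" for \<mu>
  proof -
    have "\<mu> *\<^sub>R \<xi> - \<xi> = (\<mu> - 1) *\<^sub>R \<xi>" by (simp add: algebra_simps)
    then have "ereal Q + ereal (2 * ((\<mu> - 1) * (\<zeta> \<bullet> \<xi>)) - r * ((\<mu> - 1)\<^sup>2 * (norm \<xi>)\<^sup>2)) \<le> ereal (\<mu>\<^sup>2 * Q)"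
      using order_trans[OF lower[of "\<mu> *\<^sub>R \<xi>"] second_subderivative_scale_le[OF epi that Q]]
      by (simp add: Q power_mult_distrib)
    then show ?thesis by (simp add: f_def algebra_simps)
  qed
  have "(f has_real_derivative 2 * Q - 2 * (\<zeta> \<bullet> \<xi>)) (at 1)"
    unfolding f_def by (auto intro!: derivative_eq_intros)
  moreover have "\<forall>y. \<bar>1 - y\<bar> < 1 \<longrightarrow> f 1 \<le> f y"
    using f0 by (auto simp: f_def[THEN fun_cong, of 1])
  ultimately have "2 * Q - 2 * (\<zeta> \<bullet> \<xi>) = 0" using DERIV_local_min zero_less_one by blast
  then show euler: "?q \<xi> = ereal (\<zeta> \<bullet> \<xi>)" by (simp add: Q)
  show "ereal (\<zeta> \<bullet> \<xi> + 2 * (\<zeta> \<bullet> (y - \<xi>)) - r * (norm (y - \<xi>))\<^sup>2) \<le> ?q y"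
    using lower[of y] by (simp add: euler add_diff_eq)
qed

section \<open>Normals from tangent directions\<close>

text \<open>
  A proximal normal \<open>\<nu>\<close>, at \<open>p0\<close>, to the set of directions obtained as limits of the rescaled sets
  \<open>(C - zb) / t k\<close> is a limiting normal to \<open>C\<close> at \<open>zb\<close>. Maximise
  \<open>\<nu> \<bullet> (p - p0) - (|K| + 1) |p - p0|\<^sup>2\<close> over the rescaled set near \<open>p0\<close>. By hypothesis every cluster
  point of the maximisers is \<open>p0\<close>, so they are eventually interior, and the gradients there are
  regular normals to \<open>C\<close> which converge to \<open>\<nu>\<close>.
\<close>
lemma limiting_normal_from_tangent_inequality:
  fixes C :: "'a::euclidean_space set"
  assumes \<delta>: "\<delta> > 0" and cpt: "compact (C \<inter> cball zb \<delta>)"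
    and t: "t \<longlonglongrightarrow> 0" "\<And>k::nat. t k > 0"
    and ps: "ps \<longlonglongrightarrow> p0" "\<And>k. zb + t k *\<^sub>R ps k \<in> C"
    and ineq: "\<And>\<rho> qs q. strict_mono \<rho> \<Longrightarrow> qs \<longlonglongrightarrow> q \<Longrightarrow> (\<And>k. zb + t (\<rho> k) *\<^sub>R qs k \<in> C) \<Longrightarrow>
        \<nu> \<bullet> (q - p0) \<le> K * (norm (q - p0))\<^sup>2"
  shows "\<nu> \<in> limiting_normal_cone C zb"
proof -
  define f where "f = (\<lambda>p. \<nu> \<bullet> (p - p0) - (\<bar>K\<bar> + 1) * (norm (p - p0))\<^sup>2)"
  define A where "A = (\<lambda>k. {p. zb + t k *\<^sub>R p \<in> C \<and> norm (p - p0) \<le> 1})"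
  \<comment> \<open>\<open>A k\<close> sees only the part of \<open>C\<close> in \<open>cball zb \<delta>\<close> as soon as \<open>t k\<close> is small.\<close>
  have cA: "compact (A k)" if "t k * (norm p0 + 1) \<le> \<delta>" for k
  proof -
    have n: "norm p \<le> norm p0 + 1" if "norm (p - p0) \<le> 1" for p
      using norm_triangle_sub[of p p0] that by simp
    have "A k = (\<lambda>z. (1 / t k) *\<^sub>R (z - zb)) ` (C \<inter> cball zb \<delta>) \<inter> cball p0 1"
    proof (intro equalityI subsetI)
      fix p assume p: "p \<in> A k"
      have "norm (t k *\<^sub>R p) \<le> t k * (norm p0 + 1)"
        using p t(2)[of k] n[of p] by (auto simp: A_def intro!: mult_left_mono)
      then have "zb + t k *\<^sub>R p \<in> C \<inter> cball zb \<delta>" using p that by (auto simp: A_def dist_norm)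
      moreover have "p = (1 / t k) *\<^sub>R ((zb + t k *\<^sub>R p) - zb)" using t(2)[of k] by simp
      ultimately show "p \<in> (\<lambda>z. (1 / t k) *\<^sub>R (z - zb)) ` (C \<inter> cball zb \<delta>) \<inter> cball p0 1"
        using p by (intro IntI image_eqI) (auto simp: A_def dist_norm norm_minus_commute)
    next
      fix p assume "p \<in> (\<lambda>z. (1 / t k) *\<^sub>R (z - zb)) ` (C \<inter> cball zb \<delta>) \<inter> cball p0 1"
      then show "p \<in> A k" using t(2)[of k] by (auto simp: A_def dist_norm norm_minus_commute)
    qed
    moreover have "compact ((\<lambda>z. (1 / t k) *\<^sub>R (z - zb)) ` (C \<inter> cball zb \<delta>))"
      by (intro compact_continuous_image continuous_intros cpt)
    ultimately show ?thesis by auto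
  qed
  have "(\<lambda>k. t k * (norm p0 + 1)) \<longlonglongrightarrow> 0" by (intro tendsto_mult_left_zero t)
  then have ev1: "eventually (\<lambda>k. t k * (norm p0 + 1) < \<delta>) sequentially"
    using \<delta> by (rule order_tendstoD)
  have ev2: "eventually (\<lambda>k. dist (ps k) p0 < 1) sequentially" using tendstoD[OF ps(1), of 1] by simp
  obtain N where N: "\<And>k. k \<ge> N \<Longrightarrow> t k * (norm p0 + 1) < \<delta> \<and> dist (ps k) p0 < 1"
    using eventually_conj[OF ev1 ev2] unfolding eventually_sequentially by blast
  have "\<exists>p\<in>A (k + N). \<forall>y\<in>A (k + N). f y \<le> f p" for k
  proof (rule continuous_attains_sup)
    show "compact (A (k + N))" using N[of "k + N"] by (intro cA) simp
    show "A (k + N) \<noteq> {}" using ps(2)[of "k + N"] N[of "k + N"] by (auto simp: A_def dist_norm)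
    show "continuous_on (A (k + N)) f" unfolding f_def by (intro continuous_intros)
  qed
  then obtain q where q: "\<And>k. q k \<in> A (k + N)" and qmax: "\<And>k y. y \<in> A (k + N) \<Longrightarrow> f y \<le> f (q k)"
    by metis
  have "q k \<in> cball p0 1" for k using q[of k] by (simp add: A_def dist_norm norm_minus_commute)
  then have "bounded (range q)" by (intro bounded_subset[OF bounded_cball[of p0 1]]) auto
  then obtain q0 \<rho> where \<rho>: "strict_mono \<rho>" and q0: "(q \<circ> \<rho>) \<longlonglongrightarrow> q0"
    using bounded_imp_convergent_subsequence by blast
  define \<sigma> where "\<sigma> = (\<lambda>k. \<rho> k + N)"
  have \<sigma>: "strict_mono \<sigma>" using \<rho> by (simp add: \<sigma>_def strict_mono_def)
  define qs where "qs = q \<circ> \<rho>"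
  have qs: "qs \<longlonglongrightarrow> q0" using q0 by (simp add: qs_def)
  have qsA: "qs k \<in> A (\<sigma> k)" and qsmax: "y \<in> A (\<sigma> k) \<Longrightarrow> f y \<le> f (qs k)" for k y
    using q qmax by (auto simp: qs_def \<sigma>_def)
  have "q0 = p0"
  proof -
    have "(\<lambda>k. f (ps (\<sigma> k))) \<longlonglongrightarrow> f p0"
      unfolding f_def using LIMSEQ_subseq_LIMSEQ[OF ps(1) \<sigma>] by (intro tendsto_intros) (simp_all add: o_def)
    moreover have "(\<lambda>k. f (qs k)) \<longlonglongrightarrow> f q0"
      unfolding f_def by (intro tendsto_intros qs)
    moreover have "f (ps (\<sigma> k)) \<le> f (qs k)" for k
      using ps(2) N[of "\<sigma> k"] by (intro qsmax) (auto simp: A_def dist_norm \<sigma>_def)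
    ultimately have "f p0 \<le> f q0" by (intro LIMSEQ_le) auto
    then have "0 \<le> \<nu> \<bullet> (q0 - p0) - (\<bar>K\<bar> + 1) * (norm (q0 - p0))\<^sup>2" by (simp add: f_def)
    moreover have "\<nu> \<bullet> (q0 - p0) \<le> K * (norm (q0 - p0))\<^sup>2"
      using qsA by (intro ineq[OF \<sigma> qs]) (auto simp: A_def)
    moreover have "K * (norm (q0 - p0))\<^sup>2 \<le> \<bar>K\<bar> * (norm (q0 - p0))\<^sup>2"
      by (intro mult_right_mono) auto
    moreover have "(\<bar>K\<bar> + 1) * (norm (q0 - p0))\<^sup>2 = \<bar>K\<bar> * (norm (q0 - p0))\<^sup>2 + (norm (q0 - p0))\<^sup>2"
      by (simp add: distrib_right)
    ultimately have "(norm (q0 - p0))\<^sup>2 \<le> 0" by linarith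
    then show ?thesis by simp
  qed
  obtain M where M: "\<And>k. k \<ge> M \<Longrightarrow> dist (qs k) p0 < 1"
    using tendstoD[OF qs[unfolded \<open>q0 = p0\<close>], of 1] unfolding eventually_sequentially by auto
  \<comment> \<open>The shift by \<open>M\<close> discards the maximisers that may lie on the boundary of \<open>cball p0 1\<close>.\<close>
  define z where "z = (\<lambda>k. zb + t (\<sigma> (k + M)) *\<^sub>R qs (k + M))"
  define n where "n = (\<lambda>k. \<nu> - (2 * (\<bar>K\<bar> + 1)) *\<^sub>R (qs (k + M) - p0))"
  have lim_qs: "(\<lambda>k. qs (k + M)) \<longlonglongrightarrow> p0" using qs \<open>q0 = p0\<close> by (simp add: LIMSEQ_ignore_initial_segment)
  have lim_t: "(\<lambda>k. t (\<sigma> (k + M))) \<longlonglongrightarrow> 0"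
    using LIMSEQ_ignore_initial_segment[OF LIMSEQ_subseq_LIMSEQ[OF t(1) \<sigma>], of M] by (simp add: o_def)
  show ?thesis
    unfolding limiting_normal_cone_def mem_Collect_eq
  proof (intro exI conjI allI)
    have "z \<longlonglongrightarrow> zb + 0 *\<^sub>R p0" unfolding z_def by (intro tendsto_intros lim_qs lim_t)
    then show "z \<longlonglongrightarrow> zb" by simp
    have "n \<longlonglongrightarrow> \<nu> - (2 * (\<bar>K\<bar> + 1)) *\<^sub>R (p0 - p0)" unfolding n_def by (intro tendsto_intros lim_qs)
    then show "n \<longlonglongrightarrow> \<nu>" by simp
    fix k
    define s where "s = t (\<sigma> (k + M))"
    define p where "p = qs (k + M)"
    have s: "s > 0" using t by (simp add: s_def)
    show "z k \<in> C" using qsA[of "k + M"] by (simp add: z_def A_def)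
    define d where "d = 1 - dist p p0"
    have d: "d > 0" using M[of "k + M"] by (simp add: d_def p_def)
    show "n k \<in> regular_normal_cone C (z k)"
    proof (rule proximal_normal_is_regular[where e = "s * d" and K = "(\<bar>K\<bar> + 1) / s"])
      show "s * d > 0" using s d by simp
      fix y assume y: "y \<in> C" "dist y (z k) < s * d"
      define h where "h = (1 / s) *\<^sub>R (y - z k)"
      have yh: "y - z k = s *\<^sub>R h" using s by (simp add: h_def)
      have yph: "zb + s *\<^sub>R (p + h) = y"
      proof -
        have "zb + s *\<^sub>R (p + h) = z k + s *\<^sub>R h" by (simp add: z_def s_def p_def algebra_simps)
        then show ?thesis by (simp flip: yh)
      qed
      have "norm h < d" using y s unfolding dist_norm yh by simp
      then have "norm (p + h - p0) \<le> 1"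
        using norm_triangle_ineq[of "p - p0" h] by (simp add: d_def dist_norm algebra_simps)
      then have "p + h \<in> A (\<sigma> (k + M))" using y yph by (simp add: A_def s_def)
      then have "f (p + h) \<le> f p" unfolding p_def by (rule qsmax)
      moreover have "(norm (p + h - p0))\<^sup>2 = (norm (p - p0))\<^sup>2 + 2 * ((p - p0) \<bullet> h) + (norm h)\<^sup>2"
        by (simp add: power2_norm_eq_inner algebra_simps inner_commute)
      moreover have "\<nu> \<bullet> (p + h - p0) = \<nu> \<bullet> (p - p0) + \<nu> \<bullet> h" by (simp add: algebra_simps)
      ultimately have "\<nu> \<bullet> h - 2 * (\<bar>K\<bar> + 1) * ((p - p0) \<bullet> h) \<le> (\<bar>K\<bar> + 1) * (norm h)\<^sup>2"
        by (simp add: f_def ring_distribs mult.left_commute)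
      then have "n k \<bullet> h \<le> (\<bar>K\<bar> + 1) * (norm h)\<^sup>2"
        unfolding n_def p_def[symmetric] inner_diff_left inner_scaleR_left .
      then have "s * (n k \<bullet> h) \<le> s * ((\<bar>K\<bar> + 1) * (norm h)\<^sup>2)" using s by simp
      also have "\<dots> = (\<bar>K\<bar> + 1) / s * (norm (s *\<^sub>R h))\<^sup>2"
        using s by (simp add: power_mult_distrib power2_eq_square)
      finally show "n k \<bullet> (y - z k) \<le> (\<bar>K\<bar> + 1) / s * (norm (y - z k))\<^sup>2" by (simp add: yh)
    qed
  qed
qed

text \<open>
  Solving over \<open>vb + t u\<close> with a linear error estimate yields difference quotients that stay
  bounded; their limit \<open>w\<close> is a tangent direction of the graph over \<open>u\<close>.
\<close>
lemma graphical_tangent_exists: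
  fixes C :: "('a::euclidean_space \<times> 'b::euclidean_space) set"
  assumes V: "open V" "vb \<in> V"
    and pre: "\<And>y. y \<in> V \<Longrightarrow> \<exists>x. (x, y) \<in> C \<and> dist x xb \<le> m * dist y vb"
  obtains \<tau> ws w where "\<tau> \<longlonglongrightarrow> 0" "\<And>k::nat. \<tau> k > 0" "ws \<longlonglongrightarrow> w"
    "\<And>k. (xb + \<tau> k *\<^sub>R ws k, vb + \<tau> k *\<^sub>R u) \<in> C"
proof -
  obtain e where e: "e > 0" "ball vb e \<subseteq> V" using V open_contains_ball by metis
  define t where "t = (\<lambda>k. e / (norm u + 1) * inverse (real (Suc k)))"
  have nz: "norm u + 1 \<noteq> 0" using norm_ge_zero[of u] by linarith
  have pos: "e / (norm u + 1) > 0" using e by (simp add: add_nonneg_pos)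
  have t: "t k > 0" for k unfolding t_def using pos by (rule mult_pos_pos) simp
  have t0: "t \<longlonglongrightarrow> 0" unfolding t_def by (intro tendsto_mult_right_zero LIMSEQ_inverse_real_of_nat)
  have "vb + t k *\<^sub>R u \<in> V" for k
  proof (rule set_mp[OF e(2)])
    have "t k \<le> e / (norm u + 1)"
      using pos mult_left_le[of "inverse (real (Suc k))" "e / (norm u + 1)"]
      by (simp add: t_def inverse_le_1_iff)
    then have "t k * norm u \<le> e / (norm u + 1) * norm u" by (intro mult_right_mono) auto
    also have "\<dots> < e / (norm u + 1) * (norm u + 1)" using pos by (intro mult_strict_left_mono) auto
    also have "\<dots> = e" using nz by simp
    finally show "vb + t k *\<^sub>R u \<in> ball vb e" using t[of k] by (simp add: dist_norm)
  qed
  then have "\<exists>x. (x, vb + t k *\<^sub>R u) \<in> C \<and> dist x xb \<le> m * (t k * norm u)" for k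
    using pre[of "vb + t k *\<^sub>R u"] t[of k] by (simp add: dist_norm)
  then obtain x where x: "\<And>k. (x k, vb + t k *\<^sub>R u) \<in> C" "\<And>k. dist (x k) xb \<le> m * (t k * norm u)"
    by metis
  define ws where "ws = (\<lambda>k. (1 / t k) *\<^sub>R (x k - xb))"
  have x_ws: "x k = xb + t k *\<^sub>R ws k" for k using t[of k] by (simp add: ws_def)
  have "norm (ws k) \<le> m * norm u" for k
  proof -
    have "t k * norm (ws k) \<le> t k * (m * norm u)"
      using x(2)[of k] t[of k] by (simp add: x_ws dist_norm mult_ac)
    then show ?thesis using t[of k] by simp
  qed
  then have "bounded (range ws)" by (auto simp: bounded_iff)
  then obtain w \<rho> where \<rho>: "strict_mono \<rho>" "(ws \<circ> \<rho>) \<longlonglongrightarrow> w"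
    using bounded_imp_convergent_subsequence by blast
  show ?thesis
  proof
    show "(t \<circ> \<rho>) \<longlonglongrightarrow> 0" using t0 \<rho> by (simp add: LIMSEQ_subseq_LIMSEQ)
    show "(ws \<circ> \<rho>) \<longlonglongrightarrow> w" by fact
    show "(xb + (t \<circ> \<rho>) k *\<^sub>R (ws \<circ> \<rho>) k, vb + (t \<circ> \<rho>) k *\<^sub>R u) \<in> C" for k
      using x(1)[of "\<rho> k"] by (simp add: x_ws)
  qed (use t in simp)
qed

text \<open>
  The graphical derivative is contained in the coderivative: a tangent direction \<open>(w, u)\<close> to the
  graph gives the normal \<open>(u, -w)\<close>, as for the graph of a symmetric matrix. With the
  Euler identities at \<open>(w, u)\<close> and at another tangent \<open>(\<xi>, \<zeta>)\<close>, the prox-inequality for the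
  second subderivative reads \<open>u \<bullet> w + 2 u \<bullet> (\<xi> - w) - r |\<xi> - w|\<^sup>2 \<le> \<zeta> \<bullet> \<xi>\<close>. Up to the quadratic
  error \<open>(\<zeta> - u) \<bullet> (\<xi> - w)\<close> this is \<open>u \<bullet> \<xi> - w \<bullet> \<zeta> \<le> r |\<xi> - w|\<^sup>2\<close>, so that \<open>(u, -w)\<close> is a
  proximal normal to the tangent directions.
\<close>
lemma graphical_derivative_normal:
  fixes \<phi> :: "'a::euclidean_space \<Rightarrow> ereal"
  assumes noninf: "\<And>x. \<phi> x \<noteq> - \<infinity>" and dom: "xb \<in> effective_domain \<phi>"
    and \<delta>: "\<delta> > 0" and r: "r \<ge> 0"
    and prox: "\<And>u v x. (u, v) \<in> C \<Longrightarrow> u \<in> cball xb \<delta> \<Longrightarrow> v \<in> cball vb \<delta> \<Longrightarrow>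
       x \<in> cball xb (2 * \<delta>) \<Longrightarrow> \<phi> x \<ge> \<phi> u + ereal (v \<bullet> (x - u) - r / 2 * (norm (x - u))\<^sup>2)"
    and cpt: "compact (C \<inter> cball xb \<delta> \<times> cball vb \<delta>)"
    and base: "(xb, vb) \<in> C"
    and epi: "twice_epi_differentiable \<phi> xb vb"
    and \<tau>: "\<tau> \<longlonglongrightarrow> 0" "\<And>k::nat. \<tau> k > 0"
    and ws: "ws \<longlonglongrightarrow> w" and us: "us \<longlonglongrightarrow> u"
    and inC: "\<And>k. (xb + \<tau> k *\<^sub>R ws k, vb + \<tau> k *\<^sub>R us k) \<in> C"
  shows "(u, - w) \<in> limiting_normal_cone C (xb, vb)"
proof (rule limiting_normal_from_tangent_inequality[OF \<delta> _ \<tau>,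
      where ps = "\<lambda>k. (ws k, us k)" and ?p0.0 = "(w, u)" and K = "r + 1"])
  have "cball (xb, vb) \<delta> \<subseteq> cball xb \<delta> \<times> cball vb \<delta>"
  proof
    fix z assume "z \<in> cball (xb, vb) \<delta>"
    then show "z \<in> cball xb \<delta> \<times> cball vb \<delta>"
      using dist_fst_le[of "(xb, vb)" z] dist_snd_le[of "(xb, vb)" z] by (simp add: mem_Times_iff)
  qed
  then have "C \<inter> cball (xb, vb) \<delta> = (C \<inter> cball xb \<delta> \<times> cball vb \<delta>) \<inter> cball (xb, vb) \<delta>" by blast
  then show "compact (C \<inter> cball (xb, vb) \<delta>)" using cpt by (metis closed_cball compact_Int_closed)
  show "(\<lambda>k. (ws k, us k)) \<longlonglongrightarrow> (w, u)" by (intro tendsto_intros ws us)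
  show "(xb, vb) + \<tau> k *\<^sub>R (ws k, us k) \<in> C" for k using inC by simp
  fix \<rho> :: "nat \<Rightarrow> nat" and qs q
  assume \<rho>: "strict_mono \<rho>" and qs: "qs \<longlonglongrightarrow> q" and qC: "\<And>k. (xb, vb) + \<tau> (\<rho> k) *\<^sub>R qs k \<in> C"
  obtain \<xi> \<zeta> where q: "q = (\<xi>, \<zeta>)" by (cases q)
  have "(\<lambda>k. fst (qs k)) \<longlonglongrightarrow> \<xi>" "(\<lambda>k. snd (qs k)) \<longlonglongrightarrow> \<zeta>"
    using tendsto_fst[OF qs] tendsto_snd[OF qs] by (simp_all add: q)
  moreover have "(xb + \<tau> (\<rho> k) *\<^sub>R fst (qs k), vb + \<tau> (\<rho> k) *\<^sub>R snd (qs k)) \<in> C" for k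
    using qC[of k] by (cases "qs k") simp
  moreover have "(\<lambda>k. \<tau> (\<rho> k)) \<longlonglongrightarrow> 0" using LIMSEQ_subseq_LIMSEQ[OF \<tau>(1) \<rho>] by (simp add: o_def)
  ultimately have "second_subderivative \<phi> xb vb \<xi> = ereal (\<zeta> \<bullet> \<xi>)"
    using \<tau>(2) by (intro second_subderivative_at_graphical_tangent(1)[OF noninf dom \<delta> prox base epi])
  then have "u \<bullet> w + 2 * (u \<bullet> (\<xi> - w)) - r * (norm (\<xi> - w))\<^sup>2 \<le> \<zeta> \<bullet> \<xi>"
    using second_subderivative_at_graphical_tangent(2)[OF noninf dom \<delta> prox base epi \<tau> ws us inC, of \<xi>]
    by simp
  moreover have "(\<zeta> - u) \<bullet> (\<xi> - w) \<le> (norm (\<zeta> - u))\<^sup>2 + (norm (\<xi> - w))\<^sup>2"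
    using norm_cauchy_schwarz[of "\<zeta> - u" "\<xi> - w"]
      sum_squares_bound[of "norm (\<zeta> - u)" "norm (\<xi> - w)"]
      mult_nonneg_nonneg[OF norm_ge_zero norm_ge_zero, of "\<zeta> - u" "\<xi> - w"] by linarith
  moreover have "(u, - w) \<bullet> (q - (w, u))
     = (\<zeta> - u) \<bullet> (\<xi> - w) - \<zeta> \<bullet> \<xi> + u \<bullet> w + 2 * (u \<bullet> (\<xi> - w))"
    by (simp add: q algebra_simps inner_commute)
  moreover have "r * (norm (\<xi> - w))\<^sup>2 + ((norm (\<zeta> - u))\<^sup>2 + (norm (\<xi> - w))\<^sup>2)
      \<le> (r + 1) * (norm (q - (w, u)))\<^sup>2"
    using r by (simp add: q norm_Pair algebra_simps)
  ultimately show "(u, - w) \<bullet> (q - (w, u)) \<le> (r + 1) * (norm (q - (w, u)))\<^sup>2"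
    by linarith
qed

section \<open>Solvability of the second-order inclusion\<close>
theorem theorem4p4:
  fixes \<phi> :: "real ^ 'n \<Rightarrow> ereal" and xb vb :: "real ^ 'n"
  assumes "\<And>x. \<phi> x \<noteq> -\<infinity>"
    and "xb \<in> effective_domain \<phi>"
    and "vb \<in> subdifferential \<phi> xb"
    and "continuously_prox_regular \<phi> xb vb"
    and "metrically_regular_around (subdifferential \<phi>) xb vb"
    and "CARD('n) = 1 \<or> twice_epi_differentiable \<phi> xb vb"
  shows "\<exists>d. - vb \<in> second_order_subdifferential \<phi> xb vb d"
proof -
  define C where "C = gph (subdifferential \<phi>)"
  obtain r \<delta> where r: "r > 0" and \<delta>: "\<delta> > 0"
    and prox: "\<And>u v x. (u, v) \<in> C \<Longrightarrow> u \<in> cball xb \<delta> \<Longrightarrow> v \<in> cball vb \<delta> \<Longrightarrow>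
       x \<in> cball xb (2 * \<delta>) \<Longrightarrow> \<phi> x \<ge> \<phi> u + ereal (v \<bullet> (x - u) - r / 2 * (norm (x - u))\<^sup>2)"
    and cpt: "compact (C \<inter> cball xb \<delta> \<times> cball vb \<delta>)"
    unfolding C_def using continuously_prox_regular_localization[OF assms(1,2,4)] by blast
  have base: "(xb, vb) \<in> C" using assms(3) by (simp add: C_def gph_def)
  obtain m V where m: "m > 0" and V: "open V" "vb \<in> V"
    and pre: "\<And>y. y \<in> V \<Longrightarrow> \<exists>x. (x, y) \<in> C \<and> dist x xb \<le> m * dist y vb"
    using metrically_regular_preimage[OF assms(5,3)] unfolding C_def gph_def by auto
  have "\<exists>d. (- vb, - d) \<in> limiting_normal_cone C (xb, vb)"
    using assms(6)
  proof
    assume "CARD('n) = 1"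
    then have "DIM(real ^ 'n) = 1" by simp
    then show ?thesis
    proof (rule limiting_normals_of_hypomonotone_curve[OF _ \<delta> r base cpt _ m V pre])
      fix x v x' v'
      assume *: "(x, v) \<in> C \<inter> cball xb \<delta> \<times> cball vb \<delta>" "(x', v') \<in> C \<inter> cball xb \<delta> \<times> cball vb \<delta>"
      show "- r * (norm (x - x'))\<^sup>2 \<le> (v - v') \<bullet> (x - x')"
        using * \<delta> by (intro prox_inequality_imp_hypomonotone[of \<phi>] prox assms(1))
          (auto simp: C_def gph_def subdifferential_def effective_domain_def)
    qed
  next
    assume epi: "twice_epi_differentiable \<phi> xb vb"
    obtain \<tau> ws w where \<tau>: "\<tau> \<longlonglongrightarrow> 0" "\<And>k. \<tau> k > 0" and ws: "ws \<longlonglongrightarrow> w"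
      and inC: "\<And>k. (xb + \<tau> k *\<^sub>R ws k, vb + \<tau> k *\<^sub>R (- vb)) \<in> C"
      using graphical_tangent_exists[OF V pre] by metis
    have "(- vb, - w) \<in> limiting_normal_cone C (xb, vb)"
      using graphical_derivative_normal[OF assms(1,2) \<delta> less_imp_le[OF r] prox cpt base epi \<tau> ws tendsto_const inC] .
    then show ?thesis by blast
  qed
  then show ?thesis by (simp add: second_order_subdifferential_def coderivative_def C_def)
qed

end
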